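(* Let $m,n\ge 2$ be integers, let $\underline{t}=(t_1,\dots,t_m)$ be an $m$-tuple of positive integers, and let $S=S(m,n;\underline{t})$ be the special Lie superalgebra over a field $\mathbb{F}$ of characteristic $p>2$. Then all skew-symmetric super-biderivations of $S$ are inner, i.e. $$\mathrm{BDer}(S)=\mathrm{IBDer}(S).$$
   Context: Conventions. $\mathbb{F}$ is a field of characteristic $p>2$; $\mathbb{Z}_2=\{\bar 0,\bar 1\}$; $\mathrm{d}(x)$ denotes the $\mathbb{Z}_2$-degree (parity) of $x$, and whenever $\mathrm{d}(x)$ appears, $x$ is assumed $\mathbb{Z}_2$-homogeneous. A Lie superalgebra is a superspace $L=L_{\bar 0}\oplus L_{\bar 1}$ with an even bilinear bracket satisfying $[x,y]=-(-1)^{\mathrm{d}(x)\mathrm{d}(y)}[y,x]$ and $[x,[y,z]]=[[x,y],z]+(-1)^{\mathrm{d}(x)\mathrm{d}(y)}[y,[x,z]]$. Super-biderivations. A bilinear map $\phi:L\times L\to L$ is $\mathbb{Z}_2$-homogeneous of degree $\gamma=\mathrm{d}(\phi)\in\mathbb{Z}_2$ if $\phi(L_\alpha,L_\beta)\subset L_{\alpha+\beta+\gamma}$ for all $\alpha,\beta\in\mathbb{Z}_2$; it is even if $\gamma=\bar 0$. A homogeneous bilinear map $\phi$ is a skew-symmetric super-biderivation of $L$ if for all homogeneous $x,y,z\in L$ $$\phi(x,[y,z])=[\phi(x,y),z]+(-1)^{(\mathrm{d}(\phi)+\mathrm{d}(x))\mathrm{d}(y)}[y,\phi(x,z)],$$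 $$\phi(x,y)=-(-1)^{\mathrm{d}(\phi)\mathrm{d}(x)+\mathrm{d}(\phi)\mathrm{d}(y)+\mathrm{d}(x)\mathrm{d}(y)}\phi(y,x).$$ $\mathrm{BDer}_{\gamma}(L)$ is the set of those of degree $\gamma$, and $\mathrm{BDer}(L)=\mathrm{BDer}_{\bar 0}(L)\oplus\mathrm{BDer}_{\bar 1}(L)$. For $\lambda\in\mathbb{F}$ the map $\phi_\lambda(x,y)=\lambda[x,y]$ is an (even) skew-symmetric super-biderivation; such maps are called inner, and $\mathrm{IBDer}(L)=\{\phi_\lambda\mid\lambda\in\mathbb{F}\}$. The algebra $S(m,n;\underline{t})$. Let $s=m+n$, $Y_0=\{1,\dots,m\}$, $Y_1=\{m+1,\dots,s\}$, $Y=Y_0\cup Y_1$, and $\tau(i)=\bar 0$ for $i\in Y_0$, $\tau(i)=\bar 1$ for $i\in Y_1$. Let $\pi_i=p^{t_i}-1$ and $A=\{\alpha\in\mathbb{N}^m\mid 0\le\alpha_i\le\pi_i\}$; let $B$ be the set of strictly increasing tuples $u=\langle i_1,\dots,i_k\rangle$ in $Y_1$ ($0\le k\le n$), with $x^u=x_{i_1}\cdots x_{i_k}$ and $x^{\varnothing}=1$. Let $\Lambda(m,n;\underline{t})$ be the associative superalgebra with basis $\{x^{(\alpha)}x^u\mid\alpha\in A,u\in B\}$, where $x^{(\alpha)}x^{(\beta)}=\binom{\alpha+\beta}{\alpha}x^{(\alpha+\beta)}$ with $\binom{\alpha}{\beta}=\prod_i\binom{\alpha_i}{\beta_i}$ (the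 product is $0$ when $\alpha+\beta\notin A$), $x_ix_j=-x_jx_i$ for $i,j\in Y_1$ (so $x_i^2=0$), $x^{(\alpha)}x_j=x_jx^{(\alpha)}$ for $j\in Y_1$; the $x^{(\alpha)}$ are even and the $x_j$, $j\in Y_1$, odd. For $i\in Y_0$ write $x_i=x^{(\varepsilon_i)}$, with $\varepsilon_i$ the $i$-th unit vector. Let $D_i$ ($i\in Y$) be the superderivation of parity $\tau(i)$ given by $D_i(x^{(\alpha)}x^u)=x^{(\alpha-\varepsilon_i)}x^u$ for $i\in Y_0$ (zero if $\alpha_i=0$), and $D_i(x^{(\alpha)}x^u)=x^{(\alpha)}\partial_i(x^u)$ for $i\in Y_1$, where $\partial_i$ is the odd superderivation of the Grassmann algebra with $\partial_i(x_j)=\delta_{ij}$. Let $W(m,n;\underline{t})=\{\sum_{i\in Y}f_iD_i\mid f_i\in\Lambda(m,n;\underline{t})\}$ with bracket $[fD_i,gD_j]=fD_i(g)D_j-(-1)^{\mathrm{d}(fD_i)\mathrm{d}(gD_j)}gD_j(f)D_i$. For $i,j\in Y$ and homogeneous $f\in\Lambda(m,n;\underline{t})$ put $$D_{ij}(f)=-(-1)^{\mathrm{d}(f)(\tau(i)+\tau(j))}D_j(f)D_i+(-1)^{\tau(i)\tau(j)}D_i(f)D_j,$$ extended linearly in $f$. Then $S=S(m,n;\underline{t})=\mathrm{span}_{\mathbb{F}}\{D_{ij}(f)\mid i,j\in Y,\ f\in\Lambda(m,n;\underline{t})\}$, a finite-dimensional simple Lie sub-superalgebra of $W(m,n;\underline{t})$.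 *)

theory Defs
  imports Complex_Main "HOL-Library.Z2" "HOL-Library.Function_Algebras"
begin

section \<open>Skew-symmetric super-biderivations\<close>

text \<open>Parities live in the two-element field \<^typ>\<open>bit\<close>; \<open>psign e\<close> is $(-1)^e$.\<close>

definition psign :: "bit \<Rightarrow> 'a::ring_1" where
  "psign e = (if e = 0 then 1 else - 1)"

text \<open>A superspace with a product: \<open>carr\<close> is the underlying subspace of an ambient additive group,
  \<open>part \<gamma>\<close> its homogeneous component of parity \<open>\<gamma>\<close>.\<close>

record ('a, 'v) superalg =
  carr :: "'v set"
  part :: "bit \<Rightarrow> 'v set"
  smul :: "'a \<Rightarrow> 'v \<Rightarrow> 'v"
  brk  :: "'v \<Rightarrow> 'v \<Rightarrow> 'v"

text \<open>A map \<open>L \<times> L \<rightarrow> L\<close> is represented by a curried function on the ambient type that is \<open>0\<close> as soon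
  as one argument is outside \<open>L\<close>, so that equality of maps is equality of functions and the
  pointwise sum of two maps is again such a representative.\<close>

definition bilinear_maps :: "('a, 'v::ab_group_add) superalg \<Rightarrow> ('v \<Rightarrow> 'v \<Rightarrow> 'v) set" where
  "bilinear_maps L = {\<phi>.
     (\<forall>x\<in>carr L. \<forall>y\<in>carr L. \<phi> x y \<in> carr L) \<and>
     (\<forall>x y. x \<notin> carr L \<or> y \<notin> carr L \<longrightarrow> \<phi> x y = 0) \<and>
     (\<forall>x\<in>carr L. \<forall>x'\<in>carr L. \<forall>y\<in>carr L. \<phi> (x + x') y = \<phi> x y + \<phi> x' y) \<and>
     (\<forall>x\<in>carr L. \<forall>y\<in>carr L. \<forall>y'\<in>carr L. \<phi> x (y + y') = \<phi> x y + \<phi> x y') \<and>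
     (\<forall>c. \<forall>x\<in>carr L. \<forall>y\<in>carr L. \<phi> (smul L c x) y = smul L c (\<phi> x y)) \<and>
     (\<forall>c. \<forall>x\<in>carr L. \<forall>y\<in>carr L. \<phi> x (smul L c y) = smul L c (\<phi> x y))}"

definition hom_bilinear_maps ::
    "('a, 'v::ab_group_add) superalg \<Rightarrow> bit \<Rightarrow> ('v \<Rightarrow> 'v \<Rightarrow> 'v) set" where
  "hom_bilinear_maps L \<gamma> = {\<phi> \<in> bilinear_maps L.
     \<forall>\<alpha> \<beta>. \<forall>x\<in>part L \<alpha>. \<forall>y\<in>part L \<beta>. \<phi> x y \<in> part L (\<alpha> + \<beta> + \<gamma>)}"

definition BDer_hom ::
    "('a::ring_1, 'v::ab_group_add) superalg \<Rightarrow> bit \<Rightarrow> ('v \<Rightarrow> 'v \<Rightarrow> 'v) set" where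
  "BDer_hom L \<gamma> = {\<phi> \<in> hom_bilinear_maps L \<gamma>.
     (\<forall>\<alpha> \<beta> \<delta>. \<forall>x\<in>part L \<alpha>. \<forall>y\<in>part L \<beta>. \<forall>z\<in>part L \<delta>.
        \<phi> x (brk L y z) =
          brk L (\<phi> x y) z + smul L (psign ((\<gamma> + \<alpha>) * \<beta>)) (brk L y (\<phi> x z))) \<and>
     (\<forall>\<alpha> \<beta>. \<forall>x\<in>part L \<alpha>. \<forall>y\<in>part L \<beta>.
        \<phi> x y = - smul L (psign (\<gamma> * \<alpha> + \<gamma> * \<beta> + \<alpha> * \<beta>)) (\<phi> y x))}"

definition BDer :: "('a::ring_1, 'v::ab_group_add) superalg \<Rightarrow> ('v \<Rightarrow> 'v \<Rightarrow> 'v) set" where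
  "BDer L = {\<phi>\<^sub>0 + \<phi>\<^sub>1 | \<phi>\<^sub>0 \<phi>\<^sub>1. \<phi>\<^sub>0 \<in> BDer_hom L 0 \<and> \<phi>\<^sub>1 \<in> BDer_hom L 1}"

definition inner_bider ::
    "('a, 'v::ab_group_add) superalg \<Rightarrow> 'a \<Rightarrow> 'v \<Rightarrow> 'v \<Rightarrow> 'v" where
  "inner_bider L c = (\<lambda>x y. if x \<in> carr L \<and> y \<in> carr L then smul L c (brk L x y) else 0)"

definition IBDer :: "('a, 'v::ab_group_add) superalg \<Rightarrow> ('v \<Rightarrow> 'v \<Rightarrow> 'v) set" where
  "IBDer L = range (inner_bider L)"


section \<open>The algebra \<open>\<Lambda>(m,n;t)\<close>\<close>

text \<open>The basis element $x^{(\alpha)} x^u$ is indexed by \<open>(\<alpha>, u)\<close>, where the multi-index \<open>\<alpha>\<close> is a function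
  vanishing outside \<open>{1..m}\<close> and the strictly increasing tuple \<open>u\<close> in \<open>{m+1..m+n}\<close> is given by the
  set of its entries. An element of \<open>\<Lambda>\<close> is its coefficient function, which vanishes off \<open>basis\<close>.
  The instance \<^theory>\<open>HOL-Library.Function_Algebras\<close> supplies its addition; the multiplication of
  \<open>\<Lambda>\<close> is \<open>lmult\<close> below, not the pointwise \<open>(*)\<close> of that instance.\<close>

type_synonym idx = "(nat \<Rightarrow> nat) \<times> nat set"
type_synonym 'a lam = "idx \<Rightarrow> 'a"

text \<open>An element $\sum_{i} f_i D_i$ of \<open>W(m,n;t)\<close> is the family of its coefficients $f_i$, which is
  legitimate because \<open>W\<close> is a free \<open>\<Lambda>\<close>-module on the $D_i$.\<close>

type_synonym 'a wit = "nat \<Rightarrow> 'a lam"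

definition lscale :: "'a::field \<Rightarrow> 'a lam \<Rightarrow> 'a lam" where
  "lscale c f = (\<lambda>b. c * f b)"

definition wscale :: "'a::field \<Rightarrow> 'a wit \<Rightarrow> 'a wit" where
  "wscale c X = (\<lambda>i. lscale c (X i))"

interpretation wit: vector_space "wscale :: 'a::field \<Rightarrow> 'a wit \<Rightarrow> 'a wit"
  by standard (simp_all add: wscale_def lscale_def fun_eq_iff algebra_simps)

definition mono_el :: "idx \<Rightarrow> 'a::field lam" where
  "mono_el b = (\<lambda>d. if d = b then 1 else 0)"

definition bpar :: "idx \<Rightarrow> bit" where
  "bpar b = of_nat (card (snd b))"

definition lcomp :: "bit \<Rightarrow> 'a::field lam \<Rightarrow> 'a lam" where
  "lcomp \<gamma> f = (\<lambda>b. if bpar b = \<gamma> then f b else 0)"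

context
  fixes p m n :: nat and t :: "nat \<Rightarrow> nat"
begin

definition Yset :: "nat set" where
  "Yset = {1..m + n}"

definition ypar :: "nat \<Rightarrow> bit" where
  "ypar i = (if i \<le> m then 0 else 1)"

definition Aset :: "(nat \<Rightarrow> nat) set" where
  "Aset = {\<alpha>. (\<forall>i\<in>{1..m}. \<alpha> i \<le> p ^ t i - 1) \<and> (\<forall>i. i \<notin> {1..m} \<longrightarrow> \<alpha> i = 0)}"

definition Bset :: "nat set set" where
  "Bset = Pow {m + 1..m + n}"

definition basis :: "idx set" where
  "basis = Aset \<times> Bset"

definition Lam :: "'a::field lam set" where
  "Lam = {f. \<forall>b. b \<notin> basis \<longrightarrow> f b = 0}"

text \<open>For disjoint \<open>u\<close> and \<open>v\<close>, sorting $x^u x^v$ into increasing order costs one sign per pair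
  \<open>(i, j) \<in> u \<times> v\<close> with \<open>j < i\<close>.\<close>

definition bmult :: "idx \<Rightarrow> idx \<Rightarrow> 'a::field lam" where
  "bmult b c = (case (b, c) of ((\<alpha>, u), (\<beta>, v)) \<Rightarrow>
     if \<alpha> + \<beta> \<in> Aset \<and> u \<inter> v = {}
     then lscale (of_nat (\<Prod>i = 1..m. (\<alpha> i + \<beta> i) choose \<alpha> i)
                  * (- 1) ^ card {(i, j). i \<in> u \<and> j \<in> v \<and> j < i})
            (mono_el (\<alpha> + \<beta>, u \<union> v))
     else 0)"

definition lmult :: "'a::field lam \<Rightarrow> 'a lam \<Rightarrow> 'a lam" where
  "lmult f g = (\<Sum>b\<in>basis. \<Sum>c\<in>basis. lscale (f b * g c) (bmult b c))"

definition bder :: "nat \<Rightarrow> idx \<Rightarrow> 'a::field lam" where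
  "bder i b = (case b of (\<alpha>, u) \<Rightarrow>
     if i \<le> m then (if \<alpha> i = 0 then 0 else mono_el (\<alpha>(i := \<alpha> i - 1), u))
     else (if i \<in> u then lscale ((- 1) ^ card {j \<in> u. j < i}) (mono_el (\<alpha>, u - {i})) else 0))"

definition Dd :: "nat \<Rightarrow> 'a::field lam \<Rightarrow> 'a lam" where
  "Dd i f = (\<Sum>b\<in>basis. lscale (f b) (bder i b))"


section \<open>The algebras \<open>W(m,n;t)\<close> and \<open>S(m,n;t)\<close>\<close>

text \<open>\<open>fD f i\<close> is the element $f D_i$ of \<open>W\<close>.\<close>

definition fD :: "'a::field lam \<Rightarrow> nat \<Rightarrow> 'a wit" where
  "fD f i = (\<lambda>k. if k = i then f else 0)"

definition Wset :: "'a::field wit set" where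
  "Wset = {\<Sum>i\<in>Yset. fD (f i) i | f. \<forall>i\<in>Yset. f i \<in> Lam}"

definition Wset_part :: "bit \<Rightarrow> 'a::field wit set" where
  "Wset_part \<gamma> = {X \<in> Wset. \<forall>i\<in>Yset. lcomp (\<gamma> + ypar i) (X i) = X i}"

text \<open>The bracket $[f D_i, g D_j]$ for \<open>f\<close>, \<open>g\<close> homogeneous of parities \<open>\<alpha>\<close>, \<open>\<beta>\<close>, and its bilinear
  extension via the homogeneous components of the coefficients.\<close>

definition hbracket :: "bit \<Rightarrow> 'a::field lam \<Rightarrow> nat \<Rightarrow> bit \<Rightarrow> 'a lam \<Rightarrow> nat \<Rightarrow> 'a wit" where
  "hbracket \<alpha> f i \<beta> g j =
     fD (lmult f (Dd i g)) j
     - wscale (psign ((\<alpha> + ypar i) * (\<beta> + ypar j))) (fD (lmult g (Dd j f)) i)"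

definition bracket :: "'a::field wit \<Rightarrow> 'a wit \<Rightarrow> 'a wit" where
  "bracket X Z = (\<Sum>i\<in>Yset. \<Sum>j\<in>Yset. \<Sum>\<alpha>\<in>UNIV. \<Sum>\<beta>\<in>UNIV.
     hbracket \<alpha> (lcomp \<alpha> (X i)) i \<beta> (lcomp \<beta> (Z j)) j)"

text \<open>\<open>Dij_hom \<gamma> i j f\<close> is $D_{ij}(f)$ for \<open>f\<close> homogeneous of parity \<open>\<gamma>\<close>.\<close>

definition Dij_hom :: "bit \<Rightarrow> nat \<Rightarrow> nat \<Rightarrow> 'a::field lam \<Rightarrow> 'a wit" where
  "Dij_hom \<gamma> i j f =
     - wscale (psign (\<gamma> * (ypar i + ypar j))) (fD (Dd j f) i)
     + wscale (psign (ypar i * ypar j)) (fD (Dd i f) j)"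

definition Dij :: "nat \<Rightarrow> nat \<Rightarrow> 'a::field lam \<Rightarrow> 'a wit" where
  "Dij i j f = (\<Sum>\<gamma>\<in>UNIV. Dij_hom \<gamma> i j (lcomp \<gamma> f))"

definition S_carrier :: "'a::field wit set" where
  "S_carrier = wit.span {Dij i j f | i j f. i \<in> Yset \<and> j \<in> Yset \<and> f \<in> Lam}"

definition S_alg :: "('a::field, 'a wit) superalg" where
  "S_alg = \<lparr>carr = S_carrier, part = (\<lambda>\<gamma>. S_carrier \<inter> Wset_part \<gamma>), smul = wscale, brk = bracket\<rparr>"

end

end

theory Submission
  imports Defs "HOL-Computational_Algebra.Primes"
begin

text \<open>A skew-symmetric super-biderivation \<open>\<phi>\<close> of degree \<open>\<gamma>\<close> of any Lie superalgebra over a field of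
  characteristic \<open>\<noteq> 2\<close> satisfies $[\phi(x,z),[u,v]] = \pm[[x,z],\phi(u,v)]$: expanding
  $\phi([x,u],[z,v])$ in both orders shows that the difference of the two sides is symmetric under
  $z \leftrightarrow v$ (up to Koszul signs), while it is skew under $x \leftrightarrow z$ and
  $u \leftrightarrow v$. No nonzero element of \<open>S\<close> centralizes $[S,S]$, so $\phi(x,z) = 0$ whenever
  $[x,z] = 0$. In \<open>S\<close> this
  determines everything from degrees $-1$ and $0$: with $H_{ij} = x_i D_i - (-1)^{\tau(i)+\tau(j)} x_j D_j$,
  the value $\phi(D_i, H_{ij})$ commutes with all $D_k$ and all $H_{kl}$, $k, l \ne i$, hence equals
  $\lambda_i D_i$, and $\lambda_i = 0$ if $\gamma = 1$ by parity. The identity with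
  $[u,v] = [D_i,H_{ij}] = D_i$ shows that $\phi(H_{kq}, x_k D_l) - \lambda_k x_k D_l$ is constant;
  with $[u,v]$ and $[x,z]$ of the form $x_iD_j$ it gives $\lambda_i = \lambda_j =: \lambda$, and then that the
  constant fields $\phi(x,z) - \lambda[x,z]$ vanish.

  That \<open>S\<close> is closed under the bracket rests on
  $[X,Z] = \sum_{i,k} \pm D_{ik}(X_i Z_k)$ for divergence-free \<open>X\<close> and \<open>Z\<close>.\<close>

section \<open>Parities and signs\<close>

declare add_bit_eq_xor [simp del] mult_bit_eq_and [simp del]

lemma bit_arith [simp]:
  fixes a :: bit
  shows "a + a = 0" "a * a = a" "a + (a + b) = b" "a * (a * b) = a * b"
  by (cases a; cases b; simp)+

lemma psign_simps [simp]: "psign 0 = 1" "psign 1 = - 1"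
  by (simp_all add: psign_def)

lemma psign_neq_0 [simp]: "psign a \<noteq> (0 :: 'a::ring_1_no_zero_divisors)"
  by (cases a) simp_all

lemma psign_add: "psign (a + b) = (psign a * psign b :: 'a::ring_1)"
  by (cases a; cases b; simp)

lemma psign_square [simp]: "psign a * psign a = (1 :: 'a::ring_1)"
  by (cases a; simp)

lemma psign_of_nat: "psign (of_nat k) = ((- 1) ^ k :: 'a::ring_1)"
  by (induction k) (simp_all add: psign_add)

lemma sum_fun_apply: "(\<Sum>i\<in>I. F i) x = (\<Sum>i\<in>I. F i x)"
  by (induction I rule: infinite_finite_induct) auto

interpretation lam: vector_space "lscale :: 'a::field \<Rightarrow> 'a lam \<Rightarrow> 'a lam"
  by standard (simp_all add: lscale_def fun_eq_iff algebra_simps)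

lemma lscale_apply [simp]: "lscale c f b = c * f b"
  by (simp add: lscale_def)

text \<open>If q did not divide the coefficient, the absorption identity k * (q^r choose k) = q^r *
  (q^r - 1 choose k - 1) would force q^r to divide k, which is positive and smaller.\<close>

lemma prime_dvd_choose_prime_power:
  fixes q :: nat
  assumes "prime q" "0 < k" "k < q ^ r"
  shows "q dvd (q ^ r choose k)"
proof (rule ccontr)
  assume "\<not> q dvd (q ^ r choose k)"
  then have "coprime (q ^ r) (q ^ r choose k)"
    using assms(1) by (simp add: prime_imp_coprime)
  moreover have "k * (q ^ r choose k) = q ^ r * ((q ^ r - 1) choose (k - 1))"
    using assms by (simp add: times_binomial_minus1_eq)
  ultimately have "q ^ r dvd k"
    by (metis coprime_dvd_mult_left_iff dvd_triv_left)
  then show False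
    using assms by (simp add: nat_dvd_not_less)
qed

section \<open>The superalgebra of truncated divided powers\<close>

definition inv_pairs :: "nat set \<Rightarrow> nat set \<Rightarrow> nat" where
  "inv_pairs u v = card {(i, j). i \<in> u \<and> j \<in> v \<and> j < i}"

text \<open>The number of generators that an odd derivation passes in x^u before it reaches x_i; its
  parity is the sign in \<open>bder\<close>.\<close>

definition below :: "nat \<Rightarrow> nat set \<Rightarrow> nat" where
  "below i u = card {j \<in> u. j < i}"

lemma finite_inv_pairs: "finite u \<Longrightarrow> finite v \<Longrightarrow> finite {(i, j). i \<in> u \<and> j \<in> v \<and> j < i}"
  by (rule finite_subset[of _ "u \<times> v"]) auto

lemma inv_pairs_Un_left:
  assumes "finite u" "finite v" "finite w" "u \<inter> v = {}"
  shows "inv_pairs (u \<union> v) w = inv_pairs u w + inv_pairs v w"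
proof -
  have "{(i, j). i \<in> u \<union> v \<and> j \<in> w \<and> j < i} =
      {(i, j). i \<in> u \<and> j \<in> w \<and> j < i} \<union> {(i, j). i \<in> v \<and> j \<in> w \<and> j < i}"
    by auto
  then show ?thesis
    unfolding inv_pairs_def using assms
    by (subst card_Un_disjoint[symmetric]) (auto simp: finite_inv_pairs)
qed

lemma inv_pairs_Un_right:
  assumes "finite u" "finite v" "finite w" "v \<inter> w = {}"
  shows "inv_pairs u (v \<union> w) = inv_pairs u v + inv_pairs u w"
proof -
  have "{(i, j). i \<in> u \<and> j \<in> v \<union> w \<and> j < i} =
      {(i, j). i \<in> u \<and> j \<in> v \<and> j < i} \<union> {(i, j). i \<in> u \<and> j \<in> w \<and> j < i}"
    by auto
  then show ?thesis
    unfolding inv_pairs_def using assms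
    by (subst card_Un_disjoint[symmetric]) (auto simp: finite_inv_pairs)
qed

text \<open>Each pair is an inversion in exactly one of the two orders, since disjointness excludes
  equal entries. The parity of the total is the sign of supercommutation.\<close>

lemma inv_pairs_swap:
  assumes "finite u" "finite v" "u \<inter> v = {}"
  shows "inv_pairs u v + inv_pairs v u = card u * card v"
proof -
  have 1: "inv_pairs v u = card {(i, j). i \<in> u \<and> j \<in> v \<and> i < j}"
    unfolding inv_pairs_def
    by (rule bij_betw_same_card[of prod.swap]) (force simp: bij_betw_def inj_on_def)
  have "inv_pairs u v + inv_pairs v u = card (u \<times> v)"
    unfolding 1 unfolding inv_pairs_def
  proof (subst card_Un_disjoint[symmetric])
    show "finite {(i, j). i \<in> u \<and> j \<in> v \<and> i < j}"
      by (rule finite_subset[of _ "u \<times> v"]) (use assms in auto)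
    show "card ({(i, j). i \<in> u \<and> j \<in> v \<and> j < i} \<union> {(i, j). i \<in> u \<and> j \<in> v \<and> i < j}) = card (u \<times> v)"
      using assms by (intro arg_cong[where f = card]) (auto intro: linorder_neqE_nat)
  qed (use assms finite_inv_pairs in auto)
  then show ?thesis
    by (simp add: card_cartesian_product)
qed

lemma inv_pairs_singleton_left: "inv_pairs {i} v = below i v"
proof -
  have "{(k, j). k \<in> {i} \<and> j \<in> v \<and> j < k} = Pair i ` {j \<in> v. j < i}"
    by auto
  then show ?thesis
    unfolding inv_pairs_def below_def by (simp add: card_image inj_on_def)
qed

lemma inv_pairs_singleton_right:
  assumes "finite u" "i \<notin> u"
  shows "inv_pairs u {i} + below i u = card u"
  using inv_pairs_swap[of u "{i}"] assms by (simp add: inv_pairs_singleton_left)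

lemma inv_pairs_remove_left:
  assumes "finite u" "finite v" "i \<in> u"
  shows "inv_pairs u v = inv_pairs (u - {i}) v + below i v"
  using inv_pairs_Un_left[of "u - {i}" "{i}" v] assms
  by (simp add: inv_pairs_singleton_left insert_absorb)

text \<open>Removing i from v loses the pairs (j, i) with j above i, of which there are card u -
  below i u. The additive form avoids truncated subtraction.\<close>

lemma inv_pairs_remove_right:
  assumes "finite u" "finite v" "i \<in> v" "i \<notin> u"
  shows "inv_pairs u v + below i u = inv_pairs u (v - {i}) + card u"
  using inv_pairs_Un_right[of u "v - {i}" "{i}"] inv_pairs_singleton_right[of u i] assms
  by (simp add: insert_absorb)

lemma below_Un:
  assumes "finite u" "finite v" "u \<inter> v = {}"
  shows "below i (u \<union> v) = below i u + below i v"
proof -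
  have "{j \<in> u \<union> v. j < i} = {j \<in> u. j < i} \<union> {j \<in> v. j < i}"
    by auto
  then show ?thesis
    unfolding below_def using assms by (subst card_Un_disjoint[symmetric]) auto
qed

lemma below_remove:
  assumes "finite u"  "j \<in> u"
  shows "below i (u - {j}) + (if j < i then 1 else 0) = below i u"
proof -
  have "below i u = below i (u - {j}) + below i {j}"
    using below_Un[of "u - {j}" "{j}" i] assms by (simp add: insert_absorb)
  moreover have "{k \<in> {j}. k < i} = (if j < i then {j} else {})"
    by auto
  then have "below i {j} = (if j < i then 1 else 0)"
    by (simp add: below_def)
  ultimately show ?thesis
    by simp
qed

text \<open>The case in which \<open>bmult\<close> keeps a product: no exponent is truncated and no
  odd generator is repeated.\<close>

definition okb :: "(nat \<Rightarrow> nat) set \<Rightarrow> idx \<Rightarrow> idx \<Rightarrow> bool" where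
  "okb A b c \<longleftrightarrow> fst b + fst c \<in> A \<and> snd b \<inter> snd c = {}"

definition badd :: "idx \<Rightarrow> idx \<Rightarrow> idx" where
  "badd b c = (fst b + fst c, snd b \<union> snd c)"

definition mbinom :: "nat \<Rightarrow> (nat \<Rightarrow> nat) \<Rightarrow> (nat \<Rightarrow> nat) \<Rightarrow> nat" where
  "mbinom m \<alpha> \<beta> = (\<Prod>i = 1..m. (\<alpha> i + \<beta> i) choose \<alpha> i)"

text \<open>Both sides are the product over i of the multinomial coefficients for splitting \<alpha>
  i + \<beta> i + \<gamma> i into its three parts.\<close>

lemma mbinom_assoc: "mbinom m \<alpha> \<beta> * mbinom m (\<alpha> + \<beta>) \<gamma> = mbinom m \<beta> \<gamma> * mbinom m \<alpha> (\<beta> + \<gamma>)"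
  unfolding mbinom_def prod.distrib[symmetric]
proof (rule prod.cong[OF refl])
  fix i
  show "(\<alpha> i + \<beta> i choose \<alpha> i) * ((\<alpha> + \<beta>) i + \<gamma> i choose (\<alpha> + \<beta>) i)
      = (\<beta> i + \<gamma> i choose \<beta> i) * (\<alpha> i + (\<beta> + \<gamma>) i choose \<alpha> i)"
    using choose_mult_lemma[of "\<beta> i" "\<gamma> i" "\<alpha> i"] by (simp add: ac_simps)
qed

lemma mbinom_commute: "mbinom m \<alpha> \<beta> = mbinom m \<beta> \<alpha>"
  unfolding mbinom_def
proof (rule prod.cong[OF refl])
  fix i
  show "(\<alpha> i + \<beta> i choose \<alpha> i) = (\<beta> i + \<alpha> i choose \<beta> i)"
    using binomial_symmetric[of "\<alpha> i" "\<alpha> i + \<beta> i"] by (simp add: ac_simps)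
qed

text \<open>The argument of type \<open>'a itself\<close> makes the coefficient field a parameter,
  since the characteristic is attached to a type.\<close>

locale witt_super =
  fixes field_type :: "'a::field itself" and p m n :: nat and t :: "nat \<Rightarrow> nat"
  assumes char_p: "CHAR('a) = p" and p_gt_2: "p > 2"
    and m_ge_2: "m \<ge> 2" and n_ge_2: "n \<ge> 2"
    and t_pos: "\<And>i. i \<in> {1..m} \<Longrightarrow> t i \<ge> 1"
begin

abbreviation mul :: "'a lam \<Rightarrow> 'a lam \<Rightarrow> 'a lam" (infixl "\<odot>" 70) where
  "f \<odot> g \<equiv> lmult p m n t f g"

abbreviation D :: "nat \<Rightarrow> 'a lam \<Rightarrow> 'a lam" where "D \<equiv> Dd p m n t"
abbreviation A where "A \<equiv> Aset p m t"
abbreviation basis' ("\<B>") where "\<B> \<equiv> basis p m n t"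
abbreviation Y where "Y \<equiv> Yset m n"
abbreviation par where "par \<equiv> ypar m"
abbreviation bm :: "idx \<Rightarrow> idx \<Rightarrow> 'a lam" where "bm \<equiv> bmult p m t"
abbreviation bd :: "nat \<Rightarrow> idx \<Rightarrow> 'a lam" where "bd \<equiv> bder m"
abbreviation mono :: "idx \<Rightarrow> 'a lam" where "mono \<equiv> mono_el"
abbreviation Lm :: "'a lam set" where "Lm \<equiv> Lam p m n t"

text \<open>The characteristic of a field is 0 or prime, and p > 2 excludes 0.\<close>

lemma prime_p: "prime p"
  using char_p p_gt_2 prime_CHAR_semidom[where 'a = 'a] by auto

lemma of_nat_p_dvd: "p dvd k \<Longrightarrow> of_nat k = (0 :: 'a)"
  using char_p by (simp add: of_nat_eq_0_iff_char_dvd)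

lemma two_neq_0: "(2 :: 'a) \<noteq> 0"
proof
  assume "(2 :: 'a) = 0"
  then have "of_nat 2 = (0 :: 'a)" by simp
  then have "p dvd 2" using char_p of_nat_eq_0_iff_char_dvd by metis
  then show False using p_gt_2 by (simp add: dvd_imp_le nat_dvd_not_less)
qed

lemma finite_Aset: "finite A"
proof -
  \<comment> \<open>\<open>finite_set_of_finite_funs\<close> asks for one finite range common to all
    coordinates; the sum of all p ^ t i bounds each of them.\<close>
  have "A \<subseteq> {\<alpha>. \<forall>i. (i \<in> {1..m} \<longrightarrow> \<alpha> i \<in> {..\<Sum>i = 1..m. p ^ t i}) \<and> (i \<notin> {1..m} \<longrightarrow> \<alpha> i = 0)}"
  proof
    fix \<alpha> assume "\<alpha> \<in> A"
    moreover have "p ^ t i - 1 \<le> (\<Sum>i = 1..m. p ^ t i)" if "i \<in> {1..m}" for i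
      using member_le_sum[OF that, of "\<lambda>i. p ^ t i"] by simp
    ultimately show "\<alpha> \<in> {\<alpha>. \<forall>i. (i \<in> {1..m} \<longrightarrow> \<alpha> i \<in> {..\<Sum>i = 1..m. p ^ t i}) \<and> (i \<notin> {1..m} \<longrightarrow> \<alpha> i = 0)}"
      unfolding Aset_def atMost_iff mem_Collect_eq by (meson le_trans)
  qed
  then show ?thesis
    by (rule finite_subset) (intro finite_set_of_finite_funs finite_atLeastAtMost finite_atMost)
qed

lemma finite_basis [simp]: "finite \<B>"
  by (simp add: basis_def finite_Aset Bset_def)

lemma finite_snd_basis: "b \<in> \<B> \<Longrightarrow> finite (snd b)"
  by (auto simp: basis_def Bset_def intro: finite_subset[of _ "{Suc m..m + n}"])

lemma finite_Y [simp]: "finite Y"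
  by (simp add: Yset_def)

lemma mul_add_left: "(f + g) \<odot> h = f \<odot> h + g \<odot> h"
  by (simp add: lmult_def algebra_simps lam.scale_left_distrib sum.distrib)

lemma mul_add_right: "h \<odot> (f + g) = h \<odot> f + h \<odot> g"
  by (simp add: lmult_def algebra_simps lam.scale_left_distrib sum.distrib)

lemma mul_scale_left [simp]: "lscale c f \<odot> h = lscale c (f \<odot> h)"
  by (simp add: lmult_def lam.scale_sum_right mult.assoc)

lemma mul_scale_right [simp]: "h \<odot> lscale c f = lscale c (h \<odot> f)"
  by (simp add: lmult_def lam.scale_sum_right ac_simps)

lemma mul_zero [simp]: "0 \<odot> h = 0" "h \<odot> 0 = 0"
  by (simp_all add: lmult_def)

lemma mul_minus_left [simp]: "(- f) \<odot> h = - (f \<odot> h)"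
  using mul_add_left[of "- f" f h] by (simp add: eq_neg_iff_add_eq_0)

lemma mul_minus_right [simp]: "h \<odot> (- f) = - (h \<odot> f)"
  using mul_add_right[of h "- f" f] by (simp add: eq_neg_iff_add_eq_0)

lemma mul_diff_left: "(f - g) \<odot> h = f \<odot> h - g \<odot> h"
  using mul_add_left[of f "- g" h] by simp

lemma mul_diff_right: "h \<odot> (f - g) = h \<odot> f - h \<odot> g"
  using mul_add_right[of h f "- g"] by simp

lemma mul_sum_left: "(\<Sum>i\<in>I. F i) \<odot> h = (\<Sum>i\<in>I. F i \<odot> h)"
  by (induction I rule: infinite_finite_induct)
    (simp_all only: sum.infinite sum.empty sum.insert mul_zero mul_add_left simp_thms)

lemma mul_sum_right: "h \<odot> (\<Sum>i\<in>I. F i) = (\<Sum>i\<in>I. h \<odot> F i)"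
  by (induction I rule: infinite_finite_induct)
    (simp_all only: sum.infinite sum.empty sum.insert mul_zero mul_add_right simp_thms)

lemma D_add: "D i (f + g) = D i f + D i g"
  by (simp add: Dd_def lam.scale_left_distrib sum.distrib)

lemma D_scale [simp]: "D i (lscale c f) = lscale c (D i f)"
  by (simp add: Dd_def lam.scale_sum_right)

lemma D_zero [simp]: "D i 0 = 0"
  by (simp add: Dd_def)

lemma D_minus [simp]: "D i (- f) = - D i f"
  using D_add[of i "- f" f] by (simp add: eq_neg_iff_add_eq_0)

lemma D_diff: "D i (f - g) = D i f - D i g"
  using D_add[of i f "- g"] by simp

lemma D_sum: "D i (\<Sum>j\<in>I. F j) = (\<Sum>j\<in>I. D i (F j))"
  by (induction I rule: infinite_finite_induct)
    (simp_all only: sum.infinite sum.empty sum.insert D_zero D_add simp_thms)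

text \<open>The free factor r lets the same collapse of the sum serve for products from either side
  and for derivations.\<close>

lemma sum_basis_mono:
  assumes "b \<in> \<B>"
  shows "(\<Sum>c\<in>\<B>. lscale (mono b c * r c) (F c)) = lscale (r b) (F b)"
proof -
  have "(\<Sum>c\<in>\<B>. lscale (mono b c * r c) (F c)) = (\<Sum>c\<in>\<B>. if c = b then lscale (r b) (F b) else 0)"
    by (rule sum.cong) (auto simp: mono_el_def)
  then show ?thesis using assms by simp
qed

lemma mul_mono_left: "b \<in> \<B> \<Longrightarrow> mono b \<odot> g = (\<Sum>c\<in>\<B>. lscale (g c) (bm b c))"
  unfolding lmult_def
  by (subst sum.swap) (simp add: sum_basis_mono)

lemma mul_expand_left: "f \<odot> g = (\<Sum>b\<in>\<B>. lscale (f b) (mono b \<odot> g))"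
  unfolding lmult_def[of p m n t f g]
  by (rule sum.cong) (simp_all add: mul_mono_left lam.scale_sum_right)

lemma mul_mono_right: "c \<in> \<B> \<Longrightarrow> f \<odot> mono c = (\<Sum>b\<in>\<B>. lscale (f b) (bm b c))"
  unfolding lmult_def using sum_basis_mono[of c]
  by (simp add: mult.commute)

lemma mul_expand_right: "f \<odot> g = (\<Sum>c\<in>\<B>. lscale (g c) (f \<odot> mono c))"
  unfolding lmult_def[of p m n t f g]
  by (subst sum.swap, rule sum.cong) (simp_all add: mul_mono_right lam.scale_sum_right mult.commute)

lemma mul_mono_mono: "b \<in> \<B> \<Longrightarrow> c \<in> \<B> \<Longrightarrow> mono b \<odot> mono c = bm b c"
  using sum_basis_mono[of c "\<lambda>_. 1" "bm b"] by (simp add: mul_mono_left)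

lemma D_mono: "b \<in> \<B> \<Longrightarrow> D i (mono b) = bd i b"
  using sum_basis_mono[of b "\<lambda>_. 1" "bd i"] by (simp add: Dd_def)

lemma D_expand: "D i f = (\<Sum>b\<in>\<B>. lscale (f b) (D i (mono b)))"
  unfolding Dd_def[of p m n t i f] by (rule sum.cong) (simp_all add: D_mono)

definition coef :: "idx \<Rightarrow> idx \<Rightarrow> 'a" where
  "coef b c = of_nat (mbinom m (fst b) (fst c)) * (- 1) ^ inv_pairs (snd b) (snd c)"

lemma bm_eq: "bm b c = (if okb A b c then lscale (coef b c) (mono (badd b c)) else 0)"
  by (cases b; cases c)
    (simp add: bmult_def okb_def coef_def mbinom_def inv_pairs_def badd_def)

lemma okb_basis: "b \<in> \<B> \<Longrightarrow> c \<in> \<B> \<Longrightarrow> okb A b c \<Longrightarrow> badd b c \<in> \<B>"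
  by (auto simp: okb_def badd_def basis_def Bset_def)

lemma A_add_left: "\<alpha> + \<beta> \<in> A \<Longrightarrow> \<alpha> \<in> A"
  by (auto simp: Aset_def)

lemma A_add_right: "\<alpha> + \<beta> \<in> A \<Longrightarrow> \<beta> \<in> A"
  using A_add_left[of \<beta> \<alpha>] by (simp add: add.commute)

text \<open>Since A is closed downwards, either side says that the sum of all three exponents lies
  in A and that the three odd parts are pairwise disjoint.\<close>

lemma okb_assoc: "okb A b c \<and> okb A (badd b c) d \<longleftrightarrow> okb A c d \<and> okb A b (badd c d)"
  using A_add_left[of "fst b + fst c" "fst d"] A_add_right[of "fst b" "fst c + fst d"]
  by (auto simp: okb_def badd_def add.assoc)

lemma badd_assoc: "badd (badd b c) d = badd b (badd c d)"
  by (simp add: badd_def add.assoc Un_assoc)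

text \<open>The binomial factors agree by \<open>mbinom_assoc\<close>. The sign exponents agree
  because either one is the sum of the three pairwise inversion counts.\<close>

lemma coef_assoc:
  assumes "b \<in> \<B>" "c \<in> \<B>" "d \<in> \<B>" "okb A b c" "okb A (badd b c) d"
  shows "coef b c * coef (badd b c) d = coef c d * coef b (badd c d)"
proof -
  note fin = finite_snd_basis[OF assms(1)] finite_snd_basis[OF assms(2)] finite_snd_basis[OF assms(3)]
  have disj: "snd b \<inter> snd c = {}" "snd c \<inter> snd d = {}"
    using assms by (auto simp: okb_def badd_def)
  have b: "of_nat (mbinom m (fst b) (fst c)) * of_nat (mbinom m (fst b + fst c) (fst d))
      = (of_nat (mbinom m (fst c) (fst d)) * of_nat (mbinom m (fst b) (fst c + fst d)) :: 'a)"
    unfolding of_nat_mult[symmetric] by (simp add: mbinom_assoc)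
  have "inv_pairs (snd b) (snd c) + inv_pairs (snd b \<union> snd c) (snd d)
      = inv_pairs (snd c) (snd d) + inv_pairs (snd b) (snd c \<union> snd d)"
    using fin disj by (simp add: inv_pairs_Un_left inv_pairs_Un_right)
  then have s: "(- 1) ^ inv_pairs (snd b) (snd c) * (- 1) ^ inv_pairs (snd b \<union> snd c) (snd d)
      = ((- 1) ^ inv_pairs (snd c) (snd d) * (- 1) ^ inv_pairs (snd b) (snd c \<union> snd d) :: 'a)"
    unfolding power_add[symmetric] by simp
  show ?thesis
    using arg_cong2[OF b s, of "(*)"] unfolding coef_def badd_def by (simp only: fst_conv snd_conv ac_simps)
qed

lemma bm_in_Lam:
  assumes "b \<in> \<B>" "c \<in> \<B>"
  shows "bm b c \<in> Lm"
  using okb_basis[OF assms] by (auto simp: bm_eq Lam_def mono_el_def)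

lemma mono_assoc:
  assumes "b \<in> \<B>" "c \<in> \<B>" "d \<in> \<B>"
  shows "mono b \<odot> mono c \<odot> mono d = mono b \<odot> (mono c \<odot> mono d)"
proof (cases "okb A b c \<and> okb A (badd b c) d")
  case True
  then have *: "okb A c d" "okb A b (badd c d)"
    using okb_assoc by blast+
  show ?thesis
    using True * assms coef_assoc[of b c d]
    by (simp add: mul_mono_mono bm_eq okb_basis badd_assoc)
next
  case False
  moreover have "\<not> (okb A c d \<and> okb A b (badd c d))"
    using False okb_assoc by blast
  ultimately show ?thesis
    using assms by (auto simp: mul_mono_mono bm_eq okb_basis)
qed

lemma mul_assoc: "f \<odot> g \<odot> h = f \<odot> (g \<odot> h)"
proof -
  \<comment> \<open>The basis case is extended one factor at a time: the third factor here, then the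
    second, and finally the first.\<close>
  have 1: "mono b \<odot> mono c \<odot> h = mono b \<odot> (mono c \<odot> h)" if "b \<in> \<B>" "c \<in> \<B>" for b c
    unfolding mul_expand_right[of "mono b \<odot> mono c" h] mul_expand_right[of "mono c" h]
    by (simp add: mul_sum_right mono_assoc that)
  have 2: "mono b \<odot> g \<odot> h = mono b \<odot> (g \<odot> h)" if "b \<in> \<B>" for b
    unfolding mul_expand_right[of "mono b" g] mul_expand_left[of g h]
    by (simp add: mul_sum_right mul_sum_left 1 that)
  show ?thesis
    unfolding mul_expand_left[of f g] mul_expand_left[of f "g \<odot> h"]
    by (simp add: mul_sum_left 2)
qed

section \<open>Parity, supercommutativity and the unit of the superalgebra\<close>

definition homog :: "bit \<Rightarrow> 'a lam \<Rightarrow> bool" where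
  "homog a f \<longleftrightarrow> (\<forall>b. f b \<noteq> 0 \<longrightarrow> bpar b = a)"

lemma homogD: "homog a f \<Longrightarrow> f b \<noteq> 0 \<Longrightarrow> bpar b = a"
  by (simp add: homog_def del: split_paired_All)

lemma homog_iff_lcomp: "homog a f \<longleftrightarrow> lcomp a f = f"
  by (auto simp: homog_def lcomp_def fun_eq_iff)

lemma homog_lcomp [simp]: "homog a (lcomp a f)"
  by (simp add: homog_def lcomp_def)

lemma lcomp_homog: "homog a f \<Longrightarrow> lcomp b f = (if b = a then f else 0)"
  by (auto simp: homog_def lcomp_def fun_eq_iff)

lemma homog_zero [simp]: "homog a 0"
  by (simp add: homog_def)

lemma homog_add: "homog a f \<Longrightarrow> homog a g \<Longrightarrow> homog a (f + g)"
  unfolding homog_def by (metis add_0 plus_fun_apply)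

lemma homog_scale: "homog a f \<Longrightarrow> homog a (lscale c f)"
  by (simp add: homog_def)

lemma homog_minus: "homog a f \<Longrightarrow> homog a (- f)"
  by (simp add: homog_def)

lemma homog_diff: "homog a f \<Longrightarrow> homog a g \<Longrightarrow> homog a (f - g)"
  using homog_add[of a f "- g"] homog_minus[of a g] by simp

lemma homog_sum: "(\<And>i. i \<in> I \<Longrightarrow> homog a (F i)) \<Longrightarrow> homog a (\<Sum>i\<in>I. F i)"
  by (induction I rule: infinite_finite_induct)
    (simp_all only: sum.infinite sum.empty sum.insert homog_zero homog_add insert_iff simp_thms)

lemma homog_mono: "homog a (mono b) \<longleftrightarrow> bpar b = a"
  by (simp add: homog_def mono_el_def split_paired_All[symmetric] del: split_paired_All)

lemma bpar_badd: "finite (snd b) \<Longrightarrow> finite (snd c) \<Longrightarrow> snd b \<inter> snd c = {} \<Longrightarrow> bpar (badd b c) = bpar b + bpar c"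
  by (simp add: bpar_def badd_def card_Un_disjoint)

lemma homog_bm: "b \<in> \<B> \<Longrightarrow> c \<in> \<B> \<Longrightarrow> homog (bpar b + bpar c) (bm b c)"
  by (simp add: bm_eq homog_scale homog_mono bpar_badd finite_snd_basis okb_def)

lemma homog_mul:
  assumes "homog a f" "homog b g"
  shows "homog (a + b) (f \<odot> g)"
  unfolding lmult_def
proof (intro homog_sum)
  fix c d assume "c \<in> \<B>" "d \<in> \<B>"
  then have "homog (bpar c + bpar d) (bm c d)"
    by (rule homog_bm)
  then show "homog (a + b) (lscale (f c * g d) (bm c d))"
    using homogD[OF assms(1), of c] homogD[OF assms(2), of d]
    by (cases "f c = 0 \<or> g d = 0") (auto intro: homog_scale)
qed

lemma of_nat_bit_pred: "k > 0 \<Longrightarrow> (of_nat (k - Suc 0) :: bit) = of_nat k + 1"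
  by (cases k) (auto simp: ac_simps)

lemma homog_bd: "b \<in> \<B> \<Longrightarrow> homog (bpar b + par i) (bd i b)"
  using finite_snd_basis[of b]
  by (cases b) (auto simp: bder_def ypar_def homog_mono bpar_def of_nat_bit_pred card_gt_0_iff
      intro!: homog_scale of_nat_bit_pred)

lemma homog_D:
  assumes "homog a f"
  shows "homog (a + par i) (D i f)"
  unfolding Dd_def
proof (intro homog_sum)
  fix c assume "c \<in> \<B>"
  then have "homog (bpar c + par i) (bd i c)"
    by (rule homog_bd)
  then show "homog (a + par i) (lscale (f c) (bd i c))"
    using homogD[OF assms, of c] by (cases "f c = 0") (auto intro: homog_scale)
qed

lemma Lam_add: "f \<in> Lm \<Longrightarrow> g \<in> Lm \<Longrightarrow> f + g \<in> Lm"
  by (simp add: Lam_def)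

lemma Lam_zero [simp]: "0 \<in> Lm"
  by (simp add: Lam_def)

lemma Lam_scale: "f \<in> Lm \<Longrightarrow> lscale c f \<in> Lm"
  by (simp add: Lam_def)

lemma Lam_minus: "f \<in> Lm \<Longrightarrow> - f \<in> Lm"
  by (simp add: Lam_def)

lemma Lam_diff: "f \<in> Lm \<Longrightarrow> g \<in> Lm \<Longrightarrow> f - g \<in> Lm"
  by (simp add: Lam_def)

lemma Lam_sum: "(\<And>i. i \<in> I \<Longrightarrow> F i \<in> Lm) \<Longrightarrow> (\<Sum>i\<in>I. F i) \<in> Lm"
  by (induction I rule: infinite_finite_induct)
    (simp_all only: sum.infinite sum.empty sum.insert Lam_zero Lam_add insert_iff simp_thms)

lemma Lam_lcomp: "f \<in> Lm \<Longrightarrow> lcomp a f \<in> Lm"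
  by (simp add: Lam_def lcomp_def)

lemma Lam_mono: "b \<in> \<B> \<Longrightarrow> mono b \<in> Lm"
  by (auto simp: Lam_def mono_el_def)

lemma Lam_mul: "f \<odot> g \<in> Lm"
  unfolding lmult_def by (intro Lam_sum Lam_scale bm_in_Lam)

lemma A_dec: "\<alpha> \<in> A \<Longrightarrow> \<alpha>(i := \<alpha> i - 1) \<in> A"
  by (auto simp: Aset_def intro: le_trans[OF diff_le_self])

lemma bd_in_Lam: "b \<in> \<B> \<Longrightarrow> bd i b \<in> Lm"
  by (auto simp: bder_def basis_def Bset_def A_dec[of _ i, simplified] intro!: Lam_scale Lam_mono split: prod.split)

lemma Lam_D: "D i f \<in> Lm"
  unfolding Dd_def by (intro Lam_sum Lam_scale bd_in_Lam)

lemma psign_mult_of_nat: "psign (of_nat k * of_nat l) = ((- 1) ^ (k * l) :: 'a)"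
  by (simp add: psign_of_nat flip: of_nat_mult)

lemma minus_one_power_eq:
  assumes "k + l = r"
  shows "(- 1) ^ k = ((- 1) ^ r * (- 1) ^ l :: 'a)"
  unfolding assms[symmetric] by (simp add: power_add mult.assoc flip: power_mult_distrib)

lemma bm_commute:
  assumes "b \<in> \<B>" "c \<in> \<B>"
  shows "bm b c = lscale (psign (bpar b * bpar c)) (bm c b)"
proof -
  have "okb A b c = okb A c b" "badd b c = badd c b"
    by (auto simp: okb_def badd_def add.commute)
  moreover have "coef b c = psign (bpar b * bpar c) * coef c b" if "okb A b c"
    using inv_pairs_swap[of "snd b" "snd c", THEN minus_one_power_eq] assms that
    by (simp add: coef_def finite_snd_basis okb_def bpar_def psign_mult_of_nat mbinom_commute)
  ultimately show ?thesis
    by (simp add: bm_eq)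
qed

lemma mul_commute:
  assumes "homog a f" "homog b g"
  shows "f \<odot> g = lscale (psign (a * b)) (g \<odot> f)"
proof -
  have "lscale (f c * g d) (bm c d) = lscale (psign (a * b)) (lscale (g d * f c) (bm d c))"
    if "c \<in> \<B>" "d \<in> \<B>" for c d
  \<comment> \<open>A term with a zero coefficient vanishes on both sides; otherwise homogeneity
    fixes the parities of the two basis indices.\<close>
  proof (cases "f c = 0 \<or> g d = 0")
    case False
    then have "bpar c = a" "bpar d = b"
      using homogD[OF assms(1), of c] homogD[OF assms(2), of d] by auto
    then show ?thesis
      using bm_commute[OF that] by (simp add: ac_simps)
  qed auto
  then show ?thesis
    unfolding lmult_def lam.scale_sum_right by (subst (2) sum.swap) (intro sum.cong refl)
qed

definition unit :: "'a lam" where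
  "unit = mono (0, {})"

lemma zero_in_basis [simp]: "(0, {}) \<in> \<B>"
  by (simp add: basis_def Aset_def Bset_def)

lemma Lam_eq_sum: "f \<in> Lm \<Longrightarrow> f = (\<Sum>b\<in>\<B>. lscale (f b) (mono b))"
  unfolding fun_eq_iff sum_fun_apply
proof
  fix x assume "f \<in> Lm"
  have "(\<Sum>b\<in>\<B>. lscale (f b) (mono b) x) = (\<Sum>b\<in>\<B>. if b = x then f x else 0)"
    by (rule sum.cong) (auto simp: mono_el_def)
  then show "f x = (\<Sum>b\<in>\<B>. lscale (f b) (mono b) x)"
    using \<open>f \<in> Lm\<close> by (simp add: Lam_def del: split_paired_All)
qed

lemma mul_unit_left: "f \<in> Lm \<Longrightarrow> unit \<odot> f = f"
proof -
  assume f: "f \<in> Lm"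
  have "bm (0, {}) c = mono c" if "c \<in> \<B>" for c
    using that by (auto simp: bm_eq okb_def badd_def coef_def basis_def mbinom_def inv_pairs_def)
  then show ?thesis
    unfolding unit_def using Lam_eq_sum[OF f] by (simp add: mul_mono_left)
qed

lemma homog_unit: "homog 0 unit"
  by (simp add: unit_def homog_mono bpar_def)

lemma D_unit [simp]: "D i unit = 0"
  by (simp add: unit_def D_mono bder_def)

lemma Lam_unit [simp]: "unit \<in> Lm"
  by (simp add: unit_def Lam_mono)

lemma unit_neq_0 [simp]: "unit \<noteq> 0"
  by (auto simp: unit_def mono_el_def fun_eq_iff)

section \<open>The superderivations D_i: Leibniz rule and supercommutation\<close>

definition low :: "nat \<Rightarrow> (nat \<Rightarrow> nat) \<Rightarrow> nat \<Rightarrow> nat" where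
  "low i \<alpha> = \<alpha>(i := \<alpha> i - 1)"

lemma bd_even: "i \<le> m \<Longrightarrow> bd i b = (if fst b i = 0 then 0 else mono (low i (fst b), snd b))"
  by (cases b) (simp add: bder_def low_def)

lemma bd_odd: "m < i \<Longrightarrow> bd i b = (if i \<in> snd b
    then lscale ((- 1) ^ below i (snd b)) (mono (fst b, snd b - {i})) else 0)"
  by (cases b) (simp add: bder_def below_def)

lemma low_in_A: "\<alpha> \<in> A \<Longrightarrow> low i \<alpha> \<in> A"
  using A_dec by (simp add: low_def)

lemma low_in_basis: "b \<in> \<B> \<Longrightarrow> (low i (fst b), snd b) \<in> \<B>"
  by (auto simp: basis_def low_in_A)

lemma rem_in_basis: "b \<in> \<B> \<Longrightarrow> (fst b, snd b - {i}) \<in> \<B>"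
  by (auto simp: basis_def Bset_def)

lemma par_even: "i \<le> m \<Longrightarrow> par i = 0" and par_odd: "m < i \<Longrightarrow> par i = 1"
  by (simp_all add: ypar_def)

lemma low_add_left: "\<alpha> i \<noteq> 0 \<Longrightarrow> low i \<alpha> + \<beta> = low i (\<alpha> + \<beta>)"
  by (auto simp: low_def fun_eq_iff)

lemma low_add_right: "\<beta> i \<noteq> 0 \<Longrightarrow> \<alpha> + low i \<beta> = low i (\<alpha> + \<beta>)"
  by (auto simp: low_def fun_eq_iff)

lemma mbinom_split: "i \<in> {1..m} \<Longrightarrow> mbinom m \<alpha> \<beta> =
    (\<alpha> i + \<beta> i choose \<alpha> i) * (\<Prod>j\<in>{1..m} - {i}. \<alpha> j + \<beta> j choose \<alpha> j)"
  unfolding mbinom_def by (subst prod.remove) auto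

text \<open>Pascal's rule in coordinate i, all other factors being unchanged. This is the Leibniz
  rule for divided powers.\<close>

lemma mbinom_pascal:
  assumes "i \<in> {1..m}" "\<alpha> i \<noteq> 0" "\<beta> i \<noteq> 0"
  shows "mbinom m \<alpha> \<beta> = mbinom m (low i \<alpha>) \<beta> + mbinom m \<alpha> (low i \<beta>)"
proof -
  have "\<alpha> i + \<beta> i choose \<alpha> i = (\<alpha> i - 1 + \<beta> i choose (\<alpha> i - 1)) + (\<alpha> i + (\<beta> i - 1) choose \<alpha> i)"
    using assms(2,3) by (cases "\<alpha> i"; cases "\<beta> i") simp_all
  then show ?thesis
    using assms by (simp add: mbinom_split[of i] low_def add_mult_distrib)
qed

text \<open>The boundary case of Pascal's rule: the factor at i is 1 before and after
  lowering.\<close>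

lemma mbinom_low_left:
  assumes "i \<in> {1..m}" "\<alpha> i \<noteq> 0" "\<beta> i = 0"
  shows "mbinom m \<alpha> \<beta> = mbinom m (low i \<alpha>) \<beta>"
  using assms by (simp add: mbinom_split[of i] low_def)

lemma mbinom_low_right:
  assumes "i \<in> {1..m}" "\<alpha> i = 0" "\<beta> i \<noteq> 0"
  shows "mbinom m \<alpha> \<beta> = mbinom m \<alpha> (low i \<beta>)"
  using assms by (simp add: mbinom_split[of i] low_def)

text \<open>The truncation at \<open>p ^ t i\<close> is compatible with the derivations only because the
  characteristic is \<open>p\<close>.\<close>

lemma mbinom_overflow:
  assumes "i \<in> {1..m}" "\<alpha> \<in> A" "\<beta> \<in> A" "\<alpha> + \<beta> \<notin> A" "low i (\<alpha> + \<beta>) \<in> A"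
  shows "\<alpha> i \<noteq> 0" "\<beta> i \<noteq> 0" "of_nat (mbinom m (low i \<alpha>) \<beta>) + of_nat (mbinom m \<alpha> (low i \<beta>)) = (0 :: 'a)"
proof -
  have lowD: "low i (\<alpha> + \<beta>) j \<le> p ^ t j - 1" if "j \<in> {1..m}" for j
    using assms(5) that unfolding Aset_def by blast
  have le: "\<alpha> i \<le> p ^ t i - 1" "\<beta> i \<le> p ^ t i - 1" "\<alpha> i + \<beta> i - 1 \<le> p ^ t i - 1"
    using assms(1-3) lowD[of i] by (auto simp: Aset_def low_def)
  \<comment> \<open>Lowering coordinate i brings the sum back into A, so all other coordinates are
    within bounds and the overflow occurs at i.\<close>
  have gt: "\<alpha> i + \<beta> i > p ^ t i - 1"
  proof (rule ccontr)
    assume "\<not> \<alpha> i + \<beta> i > p ^ t i - 1"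
    moreover have "\<alpha> j + \<beta> j \<le> p ^ t j - 1" if "j \<noteq> i" "j \<in> {1..m}" for j
      using lowD[of j] that by (simp add: low_def)
    moreover have "\<alpha> j + \<beta> j = 0" if "j \<notin> {1..m}" for j
      using assms(2,3) that by (auto simp: Aset_def)
    ultimately have "\<alpha> + \<beta> \<in> A"
      unfolding Aset_def by (auto simp: not_less) (metis not_less)
    then show False using assms(4) by simp
  qed
  have "p ^ t i > 0"
    using p_gt_2 by simp
  \<comment> \<open>The sum exceeds p ^ t i - 1, but after subtracting 1 no longer does, so it is
    exactly p ^ t i.\<close>
  then have eq: "\<alpha> i + \<beta> i = p ^ t i" and nz: "\<alpha> i \<noteq> 0" "\<beta> i \<noteq> 0"
    using le gt by linarith+
  show "\<alpha> i \<noteq> 0" "\<beta> i \<noteq> 0"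
    using nz by auto
  have "p dvd (p ^ t i choose \<alpha> i)"
    using nz le eq by (intro prime_dvd_choose_prime_power prime_p) linarith+
  then have "p dvd mbinom m \<alpha> \<beta>"
    using assms(1) by (simp add: mbinom_split[of i] eq)
  then show "of_nat (mbinom m (low i \<alpha>) \<beta>) + of_nat (mbinom m \<alpha> (low i \<beta>)) = (0 :: 'a)"
    using mbinom_pascal[of i \<alpha> \<beta>] nz assms(1) by (simp add: of_nat_p_dvd flip: of_nat_add)
qed

lemma D_bm_even:
  assumes "i \<in> {1..m}" "b \<in> \<B>" "c \<in> \<B>"
  shows "D i (bm b c) = bd i b \<odot> mono c + mono b \<odot> bd i c"
proof -
  obtain \<alpha> u \<beta> v where bc: "b = (\<alpha>, u)" "c = (\<beta>, v)"
    by (cases b; cases c) auto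
  have A: "\<alpha> \<in> A" "\<beta> \<in> A"
    using assms bc by (auto simp: basis_def)
  have l: "(low i \<alpha>, u) \<in> \<B>" "(low i \<beta>, v) \<in> \<B>" "(\<alpha>, u) \<in> \<B>" "(\<beta>, v) \<in> \<B>"
    using low_in_basis[OF assms(2)] low_in_basis[OF assms(3)] assms bc by auto
  have le: "i \<le> m" using assms by auto
  show ?thesis
  proof (cases "u \<inter> v = {}")
    case False
    then show ?thesis
      using l le by (simp add: bc bm_eq okb_def bd_even mul_mono_mono)
  next
    case uv: True
    have R: "bd i b \<odot> mono c + mono b \<odot> bd i c =
       (if \<alpha> i \<noteq> 0 \<and> low i (\<alpha> + \<beta>) \<in> A
         then lscale (coef (low i \<alpha>, u) c) (mono (low i (\<alpha> + \<beta>), u \<union> v)) else 0)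
       + (if \<beta> i \<noteq> 0 \<and> low i (\<alpha> + \<beta>) \<in> A
         then lscale (coef b (low i \<beta>, v)) (mono (low i (\<alpha> + \<beta>), u \<union> v)) else 0)"
      using uv l le by (simp add: bc bm_eq okb_def bd_even mul_mono_mono badd_def low_add_left low_add_right)
    show ?thesis
    proof (cases "\<alpha> + \<beta> \<in> A")
      case True
      then have ok: "okb A b c" "badd b c \<in> \<B>" "low i (\<alpha> + \<beta>) \<in> A"
        using uv l okb_basis[of b c] by (auto simp: bc okb_def low_in_A)
      have L: "D i (bm b c) = (if \<alpha> i + \<beta> i = 0 then 0
          else lscale (coef b c) (mono (low i (\<alpha> + \<beta>), u \<union> v)))"
        using ok le by (simp add: bm_eq D_mono bd_even) (simp add: badd_def bc)
      \<comment> \<open>With both exponents positive the two Leibniz terms add up by Pascal's rule;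
        with one exponent zero only the other term is present.\<close>
      consider "\<alpha> i = 0" "\<beta> i = 0" | "\<alpha> i = 0" "\<beta> i \<noteq> 0" | "\<alpha> i \<noteq> 0" "\<beta> i = 0" | "\<alpha> i \<noteq> 0" "\<beta> i \<noteq> 0"
        by auto
      then show ?thesis
        unfolding L R using ok(3) assms(1)
        by cases (simp_all add: coef_def bc mbinom_low_left mbinom_low_right mbinom_pascal[of i \<alpha> \<beta>]
            algebra_simps lam.scale_left_distrib)
    next
      case False
      \<comment> \<open>The product is truncated to 0. If the lowered exponent is admissible, the
        Leibniz terms cancel modulo p; otherwise both are truncated as well.\<close>
      then have L: "D i (bm b c) = 0"
        by (simp add: bm_eq okb_def bc)
      show ?thesis
      proof (cases "low i (\<alpha> + \<beta>) \<in> A")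
        case True
        note ov = mbinom_overflow[OF assms(1) A False True]
        show ?thesis
          unfolding L R using True ov
          by (simp add: coef_def bc lam.scale_left_distrib[symmetric] distrib_right[symmetric])
      qed (simp add: L R)
    qed
  qed
qed

lemma minus_one_power_cong: "even (k + l) \<Longrightarrow> (- 1) ^ k = ((- 1) ^ l :: 'a)"
  by (metis even_add minus_one_power_iff)

lemma D_bm_odd:
  assumes "m < i" "b \<in> \<B>" "c \<in> \<B>"
  shows "D i (bm b c) = bd i b \<odot> mono c + lscale (psign (bpar b)) (mono b \<odot> bd i c)"
proof -
  obtain \<alpha> u \<beta> v where bc: "b = (\<alpha>, u)" "c = (\<beta>, v)"
    by (cases b; cases c) auto
  have l: "(\<alpha>, u - {i}) \<in> \<B>" "(\<beta>, v - {i}) \<in> \<B>" "(\<alpha>, u) \<in> \<B>" "(\<beta>, v) \<in> \<B>"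
    using rem_in_basis[OF assms(2)] rem_in_basis[OF assms(3)] assms bc by auto
  have fin: "finite u" "finite v"
    using finite_snd_basis assms bc by force+
  define ok where "ok u v \<longleftrightarrow> \<alpha> + \<beta> \<in> A \<and> u \<inter> v = {}" for u v :: "nat set"
  define k :: 'a where "k = of_nat (mbinom m \<alpha> \<beta>)"
  have R1: "bd i b \<odot> mono c = (if i \<in> u \<and> ok (u - {i}) v
      then lscale (k * (- 1) ^ (below i u + inv_pairs (u - {i}) v)) (mono (\<alpha> + \<beta>, (u - {i}) \<union> v)) else 0)"
    using l assms(1) by (simp add: bc bm_eq okb_def ok_def bd_odd mul_mono_mono badd_def coef_def k_def power_add)
  have R2: "lscale (psign (bpar b)) (mono b \<odot> bd i c) = (if i \<in> v \<and> ok u (v - {i})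
      then lscale (k * (- 1) ^ (card u + below i v + inv_pairs u (v - {i}))) (mono (\<alpha> + \<beta>, u \<union> (v - {i}))) else 0)"
    using l assms(1) by (simp add: bc bm_eq okb_def ok_def bd_odd mul_mono_mono badd_def coef_def k_def power_add
        bpar_def psign_of_nat)
  have L: "D i (bm b c) = (if i \<in> u \<union> v \<and> ok u v
      then lscale (k * (- 1) ^ (below i (u \<union> v) + inv_pairs u v)) (mono (\<alpha> + \<beta>, u \<union> v - {i})) else 0)"
  proof (cases "ok u v")
    case True
    then have "okb A b c" "badd b c \<in> \<B>"
      using okb_basis[OF assms(2,3)] by (auto simp: ok_def okb_def bc)
    then show ?thesis
      using True assms(1)
      by (simp add: bm_eq D_mono bd_odd) (simp add: bc badd_def coef_def k_def power_add)
  next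
    case False
    then have "\<not> okb A b c" by (simp add: okb_def bc ok_def)
    then show ?thesis using False by (simp add: bm_eq)
  qed
  consider "i \<notin> u" "i \<notin> v" | "i \<in> u" "i \<notin> v" | "i \<notin> u" "i \<in> v" | "i \<in> u" "i \<in> v"
    by auto
  then show ?thesis
  proof cases
    case 1
    then show ?thesis by (simp add: L R1 R2)
  next
    case 2
    then have o: "ok (u - {i}) v = ok u v" "u \<union> v - {i} = (u - {i}) \<union> v"
      by (auto simp: ok_def)
    have "(- 1) ^ (below i (u \<union> v) + inv_pairs u v) = ((- 1) ^ (below i u + inv_pairs (u - {i}) v) :: 'a)"
      if "ok u v"
      using that 2 fin inv_pairs_remove_left[OF fin, of i] below_Un[OF fin, of i]
      by (intro minus_one_power_cong) (simp add: ok_def, presburger)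
    then show ?thesis
      using 2 by (simp add: L R1 R2 o)
  next
    case 3
    then have o: "ok u (v - {i}) = ok u v" "u \<union> v - {i} = u \<union> (v - {i})"
      by (auto simp: ok_def)
    have "(- 1) ^ (below i (u \<union> v) + inv_pairs u v) = ((- 1) ^ (card u + below i v + inv_pairs u (v - {i})) :: 'a)"
      if "ok u v"
      using that 3 fin inv_pairs_remove_right[OF fin, of i] below_Un[OF fin, of i]
      by (intro minus_one_power_cong) (simp add: ok_def, presburger)
    then show ?thesis
      using 3 by (simp add: L R1 R2 o)
  next
    \<comment> \<open>The product is 0 because x_i is repeated. Each Leibniz term removes one copy
      of x_i, and the two terms have opposite signs.\<close>
    case 4
    then have o: "ok u (v - {i}) = ok (u - {i}) v" "(u - {i}) \<union> v = u \<union> v" "u \<union> (v - {i}) = u \<union> v"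
        "\<not> ok u v"
      by (auto simp: ok_def)
    have "inv_pairs (u - {i}) v + below i (u - {i}) = inv_pairs (u - {i}) (v - {i}) + card (u - {i})"
      "inv_pairs u (v - {i}) = inv_pairs (u - {i}) (v - {i}) + below i (v - {i})"
      "below i (u - {i}) = below i u" "below i (v - {i}) = below i v" "Suc (card (u - {i})) = card u"
      using 4 fin inv_pairs_remove_right[of "u - {i}" v i] inv_pairs_remove_left[of u "v - {i}" i]
        below_remove[of u i i] below_remove[of v i i] card_Suc_Diff1[of u i] by auto
    then have "(- 1) ^ (below i u + inv_pairs (u - {i}) v) =
        ((- 1) ^ Suc (card u + below i v + inv_pairs u (v - {i})) :: 'a)"
      by (intro minus_one_power_cong) presburger
    then show ?thesis
      using 4 by (simp add: L R1 R2 o lam.scale_left_distrib[symmetric])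
  qed
qed

lemma D_bm:
  assumes "i \<in> Y" "b \<in> \<B>" "c \<in> \<B>"
  shows "D i (bm b c) = bd i b \<odot> mono c + lscale (psign (par i * bpar b)) (mono b \<odot> bd i c)"
proof (cases "i \<le> m")
  case True
  then show ?thesis
    using assms D_bm_even[of i b c] by (simp add: Yset_def par_even)
next
  case False
  then show ?thesis
    using assms D_bm_odd[of i b c] by (simp add: par_odd)
qed

lemma D_mul:
  assumes "i \<in> Y" "homog a f"
  shows "D i (f \<odot> g) = D i f \<odot> g + lscale (psign (par i * a)) (f \<odot> D i g)"
proof -
  have 1: "D i (mono b \<odot> g) = bd i b \<odot> g + lscale (psign (par i * bpar b)) (mono b \<odot> D i g)"
    if "b \<in> \<B>" for b
    unfolding mul_expand_right[of _ g] D_expand[of i g]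
    using that assms(1)
    by (simp add: D_sum mul_sum_right mul_mono_mono D_mono D_bm lam.scale_right_distrib sum.distrib
        lam.scale_sum_right ac_simps)
  have 2: "lscale (f b * psign (par i * bpar b)) h = lscale (psign (par i * a) * f b) h" for b h
    using homogD[OF assms(2), of b] by (cases "f b = 0") auto
  show ?thesis
    unfolding mul_expand_left[of f] D_expand[of i f]
    by (simp add: D_sum mul_sum_left D_mono 1 2 lam.scale_right_distrib sum.distrib lam.scale_sum_right)
qed

lemma bd_bd:
  assumes "b \<in> \<B>"
  shows "D i (bd j b) = lscale (psign (par i * par j)) (D j (bd i b))"
proof -
  consider "i \<le> m" "j \<le> m" | "i \<le> m" "m < j" | "m < i" "j \<le> m" | "m < i" "m < j"
    by linarith
  then show ?thesis
  proof cases
    case 1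
    then show ?thesis
      using assms low_in_basis[OF assms]
      by (simp add: par_even bd_even D_mono) (auto simp: low_def fun_upd_twist)
  next
    case 2
    then show ?thesis
      using assms low_in_basis[OF assms] rem_in_basis[OF assms]
      by (simp add: par_even bd_even bd_odd D_mono)
  next
    case 3
    then show ?thesis
      using assms low_in_basis[OF assms] rem_in_basis[OF assms]
      by (simp add: par_even bd_even bd_odd D_mono)
  next
    case 4
    show ?thesis
    proof (cases "i = j")
      case True
      then show ?thesis
        using 4 assms rem_in_basis[OF assms] by (simp add: par_odd bd_odd D_mono)
    next
      case False
      \<comment> \<open>Removing the smaller of i and j lowers the count for the larger by one and
        leaves the other count alone, so the two orders differ by one sign.\<close>
      have "(- 1) ^ (below j (snd b) + below i (snd b - {j})) =
          ((- 1) ^ Suc (below i (snd b) + below j (snd b - {i})) :: 'a)"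
        if "i \<in> snd b" "j \<in> snd b"
        using that False below_remove[OF finite_snd_basis[OF assms], of i j]
          below_remove[OF finite_snd_basis[OF assms], of j i]
        by (intro minus_one_power_cong) (simp split: if_splits, presburger+)
      moreover have "snd b - {j} - {i} = snd b - {i} - {j}"
        by auto
      ultimately show ?thesis
        using 4 assms False rem_in_basis[OF assms]
        by (simp add: par_odd bd_odd D_mono power_add)
    qed
  qed
qed

lemma D_commute: "D i (D j f) = lscale (psign (par i * par j)) (D j (D i f))"
  unfolding D_expand[of j f] D_expand[of i f]
  by (simp add: D_sum D_mono bd_bd[of _ i j] lam.scale_sum_right ac_simps)

end

lemma UNIV_bit: "(UNIV :: bit set) = {0, 1}"
  by (auto intro: bit.exhaust)

lemma sum_bit_delta: "(\<Sum>a\<in>UNIV. if a = (c :: bit) then F a else 0) = (F c :: 'b::comm_monoid_add)"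
  by (cases c) (simp_all add: UNIV_bit)

lemma wscale_apply [simp]: "wscale c X i = lscale c (X i)"
  by (simp add: wscale_def)

lemma fD_apply: "fD f i k = (if k = i then f else 0)"
  by (simp add: fD_def)

lemma fD_zero [simp]: "fD 0 i = 0"
  by (simp add: fun_eq_iff fD_apply)

lemma lcomp_add: "lcomp a (f + g) = lcomp a f + lcomp a g"
  by (simp add: fun_eq_iff lcomp_def)

lemma lcomp_scale: "lcomp a (lscale c f) = lscale c (lcomp a f)"
  by (simp add: fun_eq_iff lcomp_def)

lemma lcomp_zero [simp]: "lcomp a 0 = 0"
  by (simp add: fun_eq_iff lcomp_def)

lemma lcomp_parts: "lcomp 0 f + lcomp 1 f = f"
  by (auto simp: fun_eq_iff lcomp_def)

section \<open>The Lie superalgebra \<open>W(m,n;t)\<close>\<close>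

context witt_super
begin

abbreviation br :: "'a wit \<Rightarrow> 'a wit \<Rightarrow> 'a wit" where "br \<equiv> bracket p m n t"
abbreviation S :: "'a wit set" where "S \<equiv> S_carrier p m n t"
abbreviation DD :: "nat \<Rightarrow> nat \<Rightarrow> 'a lam \<Rightarrow> 'a wit" where "DD \<equiv> Dij p m n t"

text \<open>The vector field X as an operator on functions. Brackets are computed through this
  action.\<close>

definition act :: "'a wit \<Rightarrow> 'a lam \<Rightarrow> 'a lam" where
  "act X f = (\<Sum>i\<in>Y. X i \<odot> D i f)"

definition whom :: "bit \<Rightarrow> 'a wit \<Rightarrow> bool" where
  "whom a X \<longleftrightarrow> (\<forall>i\<in>Y. homog (a + par i) (X i))"

definition wcomp :: "bit \<Rightarrow> 'a wit \<Rightarrow> 'a wit" where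
  "wcomp a X = (\<lambda>i. lcomp (a + par i) (X i))"

lemma Wset_eq: "Wset p m n t = {X :: 'a wit. (\<forall>i\<in>Y. X i \<in> Lm) \<and> (\<forall>i. i \<notin> Y \<longrightarrow> X i = 0)}"
proof (rule set_eqI)
  fix X :: "'a wit"
  have *: "(\<Sum>i\<in>Y. fD (f i) i) = (\<lambda>k. if k \<in> Y then f k else 0)" for f :: "nat \<Rightarrow> 'a lam"
    by (rule ext, subst sum_fun_apply) (simp add: fD_apply)
  have "X \<in> Wset p m n t \<longleftrightarrow> (\<exists>f. X = (\<lambda>k. if k \<in> Y then f k else 0) \<and> (\<forall>i\<in>Y. f i \<in> Lm))"
    unfolding Wset_def * by blast
  also have "\<dots> \<longleftrightarrow> (\<forall>i\<in>Y. X i \<in> Lm) \<and> (\<forall>i. i \<notin> Y \<longrightarrow> X i = 0)"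
  proof
    assume "(\<forall>i\<in>Y. X i \<in> Lm) \<and> (\<forall>i. i \<notin> Y \<longrightarrow> X i = 0)"
    then show "\<exists>f. X = (\<lambda>k. if k \<in> Y then f k else 0) \<and> (\<forall>i\<in>Y. f i \<in> Lm)"
      by (intro exI[of _ X]) auto
  qed auto
  finally show "X \<in> Wset p m n t \<longleftrightarrow> X \<in> {X. (\<forall>i\<in>Y. X i \<in> Lm) \<and> (\<forall>i. i \<notin> Y \<longrightarrow> X i = 0)}"
    by simp
qed

lemma Wset_part_eq: "Wset_part p m n t a = {X \<in> Wset p m n t. whom a X}"
  by (simp add: Wset_part_def whom_def homog_iff_lcomp)

lemma whomD: "whom a X \<Longrightarrow> i \<in> Y \<Longrightarrow> homog (a + par i) (X i)"
  by (simp add: whom_def)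

lemma act_add: "act X (f + g) = act X f + act X g"
  by (simp add: act_def D_add mul_add_right sum.distrib)

lemma act_diff: "act X (f - g) = act X f - act X g"
  by (simp add: act_def D_diff mul_diff_right sum_subtractf)

lemma act_minus: "act X (- f) = - act X f"
  by (simp add: act_def sum_negf)

lemma act_zero [simp]: "act X 0 = 0"
  by (simp add: act_def)

lemma homog_act:
  assumes "whom a X" "homog b f"
  shows "homog (a + b) (act X f)"
  unfolding act_def
proof (rule homog_sum)
  fix i assume "i \<in> Y"
  then have "homog ((a + par i) + (b + par i)) (X i \<odot> D i f)"
    by (intro homog_mul homog_D whomD[OF assms(1)] assms(2))
  then show "homog (a + b) (X i \<odot> D i f)"
    by (simp add: ac_simps)
qed

lemma hbracket_zero [simp]:
  "hbracket p m n t a 0 i b g j = (0 :: 'a wit)" "hbracket p m n t a f i b 0 j = (0 :: 'a wit)"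
  by (simp_all add: hbracket_def fun_eq_iff fD_apply)

text \<open>The coefficient X i has parity a + par i, so adding par i in \<open>hbracket\<close>
  gives back a. Hence every sign is (-1)^(a b), and the double sum separates into the two
  actions.\<close>

lemma br_apply:
  assumes "whom a X" "whom b Z"
  shows "br X Z k = (if k \<in> Y then act X (Z k) - lscale (psign (a * b)) (act Z (X k)) else 0)"
proof -
  have "br X Z k = (\<Sum>i\<in>Y. \<Sum>j\<in>Y. hbracket p m n t (a + par i) (X i) i (b + par j) (Z j) j k)"
  proof -
    have "hbracket p m n t c (lcomp c (X i)) i d (lcomp d (Z j)) j =
       (if c = a + par i then if d = b + par j then hbracket p m n t c (X i) i d (Z j) j else 0 else 0)"
      if "i \<in> Y" "j \<in> Y" for i j c d
      using lcomp_homog[OF whomD[OF assms(1) that(1)], of c] lcomp_homog[OF whomD[OF assms(2) that(2)], of d]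
      by simp
    then have "br X Z = (\<Sum>i\<in>Y. \<Sum>j\<in>Y. \<Sum>c\<in>UNIV. \<Sum>d\<in>UNIV.
      if c = a + par i then if d = b + par j then hbracket p m n t c (X i) i d (Z j) j else 0 else 0)"
      unfolding bracket_def by (intro sum.cong refl) simp
    also have "\<dots> = (\<Sum>i\<in>Y. \<Sum>j\<in>Y. \<Sum>c\<in>UNIV.
      if c = a + par i then hbracket p m n t c (X i) i (b + par j) (Z j) j else 0)"
      by (intro sum.cong refl) (simp add: sum_bit_delta)
    finally show ?thesis
      by (simp add: sum_bit_delta sum_fun_apply)
  qed
  also have "\<dots> = (\<Sum>i\<in>Y. \<Sum>j\<in>Y. (if j = k then X i \<odot> D i (Z j) else 0)
      - (if i = k then lscale (psign (a * b)) (Z j \<odot> D j (X i)) else 0))"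
    by (intro sum.cong refl) (auto simp: hbracket_def fD_apply ac_simps)
  also have "\<dots> = (\<Sum>i\<in>Y. \<Sum>j\<in>Y. if j = k then X i \<odot> D i (Z j) else 0)
      - (\<Sum>j\<in>Y. \<Sum>i\<in>Y. if i = k then lscale (psign (a * b)) (Z j \<odot> D j (X i)) else 0)"
    unfolding sum_subtractf by (subst (3) sum.swap) (rule refl)
  also have "\<dots> = (if k \<in> Y then act X (Z k) - lscale (psign (a * b)) (act Z (X k)) else 0)"
    by (simp add: act_def lam.scale_sum_right)
  finally show ?thesis .
qed

lemma hbracket_add:
  "hbracket p m n t a (f + f') i b g j = hbracket p m n t a f i b g j + (hbracket p m n t a f' i b g j :: 'a wit)"
  "hbracket p m n t a f i b (g + g') j = hbracket p m n t a f i b g j + (hbracket p m n t a f i b g' j :: 'a wit)"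
  by (simp_all add: hbracket_def fun_eq_iff fD_apply mul_add_left mul_add_right D_add algebra_simps)

lemma hbracket_scale:
  "hbracket p m n t a (lscale c f) i b g j = wscale c (hbracket p m n t a f i b g j :: 'a wit)"
  "hbracket p m n t a f i b (lscale c g) j = wscale c (hbracket p m n t a f i b g j :: 'a wit)"
  by (simp_all add: hbracket_def fun_eq_iff fD_apply algebra_simps)

lemma br_add_left: "br (X + X') Z = br X Z + br X' Z"
  by (simp add: bracket_def lcomp_add hbracket_add sum.distrib)

lemma br_add_right: "br X (Z + Z') = br X Z + br X Z'"
  by (simp add: bracket_def lcomp_add hbracket_add sum.distrib)

lemma br_scale_left: "br (wscale c X) Z = wscale c (br X Z)"
  by (simp add: bracket_def lcomp_scale hbracket_scale wit.scale_sum_right)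

lemma br_scale_right: "br X (wscale c Z) = wscale c (br X Z)"
  by (simp add: bracket_def lcomp_scale hbracket_scale wit.scale_sum_right)

lemma br_zero [simp]: "br 0 Z = 0" "br X 0 = 0"
  by (simp_all add: bracket_def)

lemma br_minus_left [simp]: "br (- X) Z = - br X Z"
  using br_add_left[of "- X" X Z] by (simp add: eq_neg_iff_add_eq_0)

lemma br_minus_right [simp]: "br X (- Z) = - br X Z"
  using br_add_right[of X "- Z" Z] by (simp add: eq_neg_iff_add_eq_0)

lemma br_diff_left: "br (X - X') Z = br X Z - br X' Z"
  using br_add_left[of X "- X'" Z] by simp

lemma br_diff_right: "br X (Z - Z') = br X Z - br X Z'"
  using br_add_right[of X Z "- Z'"] by simp

lemma br_sum_left: "br (\<Sum>i\<in>I. F i) Z = (\<Sum>i\<in>I. br (F i) Z)"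
  by (induction I rule: infinite_finite_induct)
    (simp_all only: sum.infinite sum.empty sum.insert br_zero br_add_left simp_thms)

lemma whom_br:
  assumes "whom a X" "whom b Z"
  shows "whom (a + b) (br X Z)"
proof -
  have "homog (a + b + par k) (act X (Z k))" "homog (a + b + par k) (act Z (X k))" if "k \<in> Y" for k
    using homog_act[OF assms(1) whomD[OF assms(2) that]] homog_act[OF assms(2) whomD[OF assms(1) that]]
    by (simp_all add: ac_simps)
  then show ?thesis
    unfolding whom_def using assms by (simp add: br_apply homog_diff homog_scale)
qed

text \<open>The Leibniz rule splits the composition into a first-order part and a second-order part;
  the latter is what cancels in a supercommutator.\<close>

lemma act_act:
  assumes "whom b Z"
  shows "act X (act Z f) = (\<Sum>j\<in>Y. act X (Z j) \<odot> D j f)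
    + (\<Sum>i\<in>Y. \<Sum>j\<in>Y. lscale (psign (par i * (b + par j))) (X i \<odot> Z j \<odot> D i (D j f)))"
proof -
  have "act X (act Z f) = (\<Sum>i\<in>Y. \<Sum>j\<in>Y. X i \<odot> D i (Z j) \<odot> D j f
     + lscale (psign (par i * (b + par j))) (X i \<odot> Z j \<odot> D i (D j f)))"
    unfolding act_def D_sum mul_sum_right
    by (intro sum.cong refl) (simp add: D_mul[OF _ whomD[OF assms]] mul_add_right mul_assoc)
  also have "\<dots> = (\<Sum>j\<in>Y. act X (Z j) \<odot> D j f)
    + (\<Sum>i\<in>Y. \<Sum>j\<in>Y. lscale (psign (par i * (b + par j))) (X i \<odot> Z j \<odot> D i (D j f)))"
    unfolding sum.distrib act_def mul_sum_left by (subst sum.swap) (rule refl)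
  finally show ?thesis .
qed

text \<open>The second-order parts of the two compositions coincide after exchanging the summation
  indices, because both the D_i and the coefficients supercommute. The first-order parts make up the
  bracket.\<close>

lemma act_br:
  assumes "whom a X" "whom b Z"
  shows "act (br X Z) f = act X (act Z f) - lscale (psign (a * b)) (act Z (act X f))"
proof -
  have "lscale (psign (a * b)) (\<Sum>i\<in>Y. \<Sum>j\<in>Y. lscale (psign (par i * (a + par j))) (Z i \<odot> X j \<odot> D i (D j f)))
     = (\<Sum>j\<in>Y. \<Sum>i\<in>Y. lscale (psign (a * b)) (lscale (psign (par i * (a + par j))) (Z i \<odot> X j \<odot> D i (D j f))))"
    unfolding lam.scale_sum_right by (rule sum.swap)
  also have "\<dots> = (\<Sum>i\<in>Y. \<Sum>j\<in>Y. lscale (psign (par i * (b + par j))) (X i \<odot> Z j \<odot> D i (D j f)))"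
  proof (intro sum.cong refl)
    fix i j assume "i \<in> Y" "j \<in> Y"
    then have 1: "Z j \<odot> X i = lscale (psign ((b + par j) * (a + par i))) (X i \<odot> Z j)"
      by (intro mul_commute whomD[OF assms(1)] whomD[OF assms(2)])
    have "psign (a * b) * (psign (par j * (a + par i)) * (psign (par j * par i) * psign ((b + par j) * (a + par i))))
       = (psign (par i * (b + par j)) :: 'a)"
      by (cases a; cases b; cases "par i"; cases "par j"; simp)
    then show "lscale (psign (a * b)) (lscale (psign (par j * (a + par i))) (Z j \<odot> X i \<odot> D j (D i f))) =
        lscale (psign (par i * (b + par j))) (X i \<odot> Z j \<odot> D i (D j f))"
      unfolding 1 D_commute[of j i]
      by (simp only: mul_scale_left mul_scale_right lam.scale_scale mult.assoc)
  qed
  finally have 2: "lscale (psign (a * b)) (\<Sum>i\<in>Y. \<Sum>j\<in>Y. lscale (psign (par i * (a + par j))) (Z i \<odot> X j \<odot> D i (D j f)))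
     = (\<Sum>i\<in>Y. \<Sum>j\<in>Y. lscale (psign (par i * (b + par j))) (X i \<odot> Z j \<odot> D i (D j f)))" .
  have "act (br X Z) f = (\<Sum>k\<in>Y. act X (Z k) \<odot> D k f) - lscale (psign (a * b)) (\<Sum>k\<in>Y. act Z (X k) \<odot> D k f)"
    unfolding act_def[of "br X Z"] lam.scale_sum_right sum_subtractf[symmetric]
    by (intro sum.cong refl) (simp add: br_apply[OF assms] mul_diff_left)
  then show ?thesis
    unfolding act_act[OF assms(1)] act_act[OF assms(2)] lam.scale_right_distrib 2 by simp
qed

lemma br_skew:
  assumes "whom a X" "whom b Z"
  shows "br X Z = - wscale (psign (a * b)) (br Z X)"
proof
  fix k
  show "br X Z k = (- wscale (psign (a * b)) (br Z X)) k"
    by (cases a; cases b; simp add: br_apply[OF assms] br_apply[OF assms(2,1)])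
qed

text \<open>By \<open>br_apply\<close> and \<open>act_br\<close> every component is a signed sum of
  compositions of two actions on components of X, Z and V; these match for each of the eight choices
  of parities.\<close>

lemma br_jacobi:
  assumes X: "whom a X" and Z: "whom b Z" and V: "whom c V"
  shows "br X (br Z V) = br (br X Z) V + wscale (psign (a * b)) (br Z (br X V))"
proof
  fix k
  note h = whom_br[OF X Z] whom_br[OF Z V] whom_br[OF X V]
  show "br X (br Z V) k = (br (br X Z) V + wscale (psign (a * b)) (br Z (br X V))) k"
  proof (cases "k \<in> Y")
    case True
    then have "br X (br Z V) k = act X (act Z (V k) - lscale (psign (b * c)) (act V (Z k)))
        - lscale (psign (a * (b + c))) (act Z (act V (X k)) - lscale (psign (b * c)) (act V (act Z (X k))))"
      by (simp add: br_apply[OF X h(2)] br_apply[OF Z V] act_br[OF Z V])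
    moreover have "br (br X Z) V k = act X (act Z (V k)) - lscale (psign (a * b)) (act Z (act X (V k)))
        - lscale (psign ((a + b) * c)) (act V (act X (Z k) - lscale (psign (a * b)) (act Z (X k))))"
      using True by (simp add: br_apply[OF h(1) V] br_apply[OF X Z] act_br[OF X Z])
    moreover have "br Z (br X V) k = act Z (act X (V k) - lscale (psign (a * c)) (act V (X k)))
        - lscale (psign (b * (a + c))) (act X (act V (Z k)) - lscale (psign (a * c)) (act V (act X (Z k))))"
      using True by (simp add: br_apply[OF Z h(3)] br_apply[OF X V] act_br[OF X V])
    ultimately show ?thesis
      by (cases a; cases b; cases c; simp add: act_diff act_add act_minus)
  next
    case False
    then show ?thesis
      by (simp add: br_apply[OF X h(2)] br_apply[OF h(1) V] br_apply[OF Z h(3)])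
  qed
qed

section \<open>The subalgebra \<open>S(m,n;t)\<close>\<close>

text \<open>The superdivergence. Its vanishing on S (\<open>S_Div\<close>) is what makes brackets
  expressible through the generators.\<close>

definition Div :: "'a wit \<Rightarrow> 'a lam" where
  "Div X = (\<Sum>i\<in>Y. \<Sum>a\<in>UNIV. lscale (psign (par i * a)) (D i (lcomp a (X i))))"

lemma Div_add: "Div (X + Z) = Div X + Div Z"
  by (simp add: Div_def lcomp_add D_add lam.scale_right_distrib sum.distrib)

lemma Div_scale: "Div (wscale c X) = lscale c (Div X)"
  by (simp add: Div_def lcomp_scale lam.scale_sum_right mult.commute)

lemma Div_homog:
  assumes "whom a X"
  shows "Div X = (\<Sum>i\<in>Y. lscale (psign (par i * (a + par i))) (D i (X i)))"
  unfolding Div_def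
proof (intro sum.cong refl)
  fix i assume i: "i \<in> Y"
  have "(\<Sum>c\<in>UNIV. lscale (psign (par i * c)) (D i (lcomp c (X i))))
     = (\<Sum>c\<in>UNIV. if c = a + par i then lscale (psign (par i * c)) (D i (X i)) else 0)"
    using lcomp_homog[OF whomD[OF assms i]] by (intro sum.cong refl) simp
  then show "(\<Sum>c\<in>UNIV. lscale (psign (par i * c)) (D i (lcomp c (X i))))
      = lscale (psign (par i * (a + par i))) (D i (X i))"
    by (simp add: sum_bit_delta)
qed

lemma DD_homog:
  assumes "homog g f"
  shows "DD i j f k = - lscale (psign (g * (par i + par j))) (if k = i then D j f else 0)
    + lscale (psign (par i * par j)) (if k = j then D i f else 0)"
proof -
  have "DD i j f = (\<Sum>c\<in>UNIV. if c = g then Dij_hom p m n t c i j f else 0)"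
    unfolding Dij_def using lcomp_homog[OF assms]
    by (intro sum.cong refl) (simp add: Dij_hom_def)
  then show ?thesis
    by (simp add: sum_bit_delta Dij_hom_def fD_apply)
qed

lemma DD_add: "DD i j (f + g) = DD i j f + DD i j g"
  by (simp add: Dij_def Dij_hom_def lcomp_add D_add fun_eq_iff fD_apply UNIV_bit algebra_simps)

lemma DD_parts: "DD i j f = DD i j (lcomp 0 f) + DD i j (lcomp 1 f)"
  by (simp only: DD_add[symmetric] lcomp_parts)

lemma whom_DD:
  assumes "homog g f"
  shows "whom (g + par i + par j) (DD i j f)"
  unfolding whom_def
proof
  fix k
  have "homog (g + par i) (D i f)" "homog (g + par j) (D j f)"
    using assms by (auto intro: homog_D)
  then show "homog (g + par i + par j + par k) (DD i j f k)"
    by (auto simp: DD_homog[OF assms] ac_simps intro!: homog_add homog_diff homog_minus homog_scale)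
qed

lemma DD_in_Wset:
  assumes "i \<in> Y" "j \<in> Y"
  shows "DD i j f \<in> Wset p m n t"
proof -
  have "DD i j f k \<in> Lm" "k \<notin> Y \<Longrightarrow> DD i j f k = 0" for k
    using assms
    by (auto simp: DD_parts[of i j f] DD_homog[OF homog_lcomp] intro!: Lam_add Lam_diff Lam_minus Lam_scale Lam_D)
  then show ?thesis
    by (auto simp: Wset_eq)
qed

lemma DD_in_S: "i \<in> Y \<Longrightarrow> j \<in> Y \<Longrightarrow> f \<in> Lm \<Longrightarrow> DD i j f \<in> S"
  unfolding S_carrier_def by (rule wit.span_base) auto

text \<open>The two terms of D_ij(f) contribute D_i D_j f and D_j D_i f, which cancel by
  supercommutation once f is split into homogeneous parts.\<close>

lemma Div_DD:
  assumes "i \<in> Y" "j \<in> Y"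
  shows "Div (DD i j f) = 0"
proof -
  have "Div (DD i j f) = 0" if h: "homog g f" for f g
  proof -
    have "lscale (psign (par k * (g + par i + par j + par k))) (D k (DD i j f k))
      = (if k = i then - lscale (psign (par i * (g + par j) + g * (par i + par j))) (D i (D j f)) else 0)
      + (if k = j then lscale (psign (par j * (g + par i) + par i * par j)) (D j (D i f)) else 0)" for k
      unfolding DD_homog[OF h] psign_add
      by (auto simp: D_add D_diff ac_simps lam.scale_right_distrib lam.scale_right_diff_distrib)
    then have "Div (DD i j f) = - lscale (psign (par i * (g + par j) + g * (par i + par j))) (D i (D j f))
       + lscale (psign (par j * (g + par i) + par i * par j)) (D j (D i f))"
      unfolding Div_homog[OF whom_DD[OF h]] using assms by (simp add: sum.distrib)
    then show ?thesis
      unfolding D_commute[of i j] by (cases g; cases "par i"; cases "par j"; simp)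
  qed
  from this[OF homog_lcomp] show ?thesis
    by (subst DD_parts) (simp add: Div_add)
qed

lemma S_induct [consumes 1, case_names zero add scale gen]:
  assumes "X \<in> S" "P 0" "\<And>X Z. X \<in> S \<Longrightarrow> Z \<in> S \<Longrightarrow> P X \<Longrightarrow> P Z \<Longrightarrow> P (X + Z)"
    "\<And>c X. X \<in> S \<Longrightarrow> P X \<Longrightarrow> P (wscale c X)"
    "\<And>i j f. i \<in> Y \<Longrightarrow> j \<in> Y \<Longrightarrow> f \<in> Lm \<Longrightarrow> P (DD i j f)"
  shows "P X"
proof -
  have "X \<in> {X \<in> S. P X}"
  proof (rule wit.span_induct_alt)
    show "X \<in> wit.span {DD i j f |i j f. i \<in> Y \<and> j \<in> Y \<and> f \<in> Lm}"
      using assms(1) by (simp only: S_carrier_def)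
  next
    show "0 \<in> {X \<in> S. P X}"
      using assms(2) by (simp add: S_carrier_def wit.span_zero)
  next
    fix c X Z assume "X \<in> {DD i j f |i j f. i \<in> Y \<and> j \<in> Y \<and> f \<in> Lm}" "Z \<in> {X \<in> S. P X}"
    moreover from this have "X \<in> S" "P X"
      using DD_in_S assms(5) by auto
    ultimately show "wscale c X + Z \<in> {X \<in> S. P X}"
      using assms(3,4) by (simp add: S_carrier_def wit.span_add wit.span_scale)
  qed
  then show ?thesis by simp
qed

lemma S_add: "X \<in> S \<Longrightarrow> Z \<in> S \<Longrightarrow> X + Z \<in> S"
  and S_scale: "X \<in> S \<Longrightarrow> wscale c X \<in> S"
  and S_zero: "0 \<in> S"
  by (simp_all add: S_carrier_def wit.span_add wit.span_scale wit.span_zero)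

lemma S_sum: "(\<And>i. i \<in> I \<Longrightarrow> F i \<in> S) \<Longrightarrow> (\<Sum>i\<in>I. F i) \<in> S"
  by (simp add: S_carrier_def wit.span_sum)

lemma S_Wset: "X \<in> S \<Longrightarrow> X \<in> Wset p m n t"
  by (erule S_induct[of X "\<lambda>X. X \<in> Wset p m n t"]; (intro DD_in_Wset; assumption)?)
    (simp_all add: Wset_eq Lam_add Lam_scale)

lemma S_Div: "X \<in> S \<Longrightarrow> Div X = 0"
proof (erule S_induct[of X "\<lambda>X. Div X = 0"])
  show "Div 0 = 0" by (simp add: Div_def)
qed (simp_all only: Div_add Div_scale Div_DD lam.scale_zero_right add_0)

lemma wcomp_add: "wcomp a (X + Z) = wcomp a X + wcomp a Z"
  by (simp add: wcomp_def lcomp_add fun_eq_iff)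

lemma wcomp_whom: "whom g X \<Longrightarrow> X \<in> Wset p m n t \<Longrightarrow> wcomp a X = (if a = g then X else 0)"
proof
  fix i
  assume "whom g X" "X \<in> Wset p m n t"
  then show "wcomp a X i = (if a = g then X else 0) i"
    by (cases "i \<in> Y") (simp_all add: wcomp_def Wset_eq lcomp_homog[OF whomD])
qed

lemma wcomp_scale: "wcomp a (wscale c X) = wscale c (wcomp a X)"
  by (simp add: wcomp_def lcomp_scale fun_eq_iff)

lemma whom_wcomp: "whom a (wcomp a X)"
  by (simp add: wcomp_def whom_def)

text \<open>S is a graded subspace: D_ij(f) is the sum of its values at the parity components of f,
  and each of these is homogeneous.\<close>

lemma S_wcomp: "X \<in> S \<Longrightarrow> wcomp a X \<in> S"
proof (erule S_induct[of X "\<lambda>X. wcomp a X \<in> S"])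
  show "wcomp a 0 \<in> S"
    using S_zero by (simp add: wcomp_def zero_fun_def[symmetric])
next
  fix i j f assume ij: "i \<in> Y" "j \<in> Y" and f: "f \<in> Lm"
  have "wcomp a (DD i j (lcomp g f)) \<in> S" for g
    using DD_in_S[OF ij Lam_lcomp[OF f]] S_zero
    by (simp add: wcomp_whom[OF whom_DD[OF homog_lcomp] DD_in_Wset[OF ij]])
  then show "wcomp a (DD i j f) \<in> S"
    by (subst DD_parts) (simp add: wcomp_add S_add)
qed (simp_all add: wcomp_add wcomp_scale S_add S_scale)

lemma wcomp_parts: "wcomp 0 X + wcomp 1 X = X"
proof
  fix i
  show "(wcomp 0 X + wcomp 1 X) i = X i"
    using lcomp_parts[of "X i"] by (cases "par i") (simp_all add: wcomp_def add.commute)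
qed

text \<open>At component l, one term of each generator D_ik(X_i Z_k) collects to the action of X on
  Z_l, and the other to the action of Z on X_l.\<close>

lemma br_divfree:
  assumes X: "whom a X" "Div X = 0" and Z: "whom b Z" "Div Z = 0"
  shows "br X Z = (\<Sum>i\<in>Y. \<Sum>k\<in>Y. wscale (psign (par i * (a + par i) + par i * par k)) (DD i k (X i \<odot> Z k)))"
    (is "_ = ?R")
proof
  fix l
  have h: "homog (a + b + par i + par k) (X i \<odot> Z k)" if "i \<in> Y" "k \<in> Y" for i k
    using homog_mul[OF whomD[OF X(1) that(1)] whomD[OF Z(1) that(2)]] by (simp add: ac_simps)
  \<comment> \<open>For divergence-free X the Leibniz terms that differentiate X i sum to zero, so
    the action is a signed sum of total derivatives of products.\<close>
  have div: "act X (Z l) = (\<Sum>i\<in>Y. lscale (psign (par i * (a + par i))) (D i (X i \<odot> Z l)))"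
    if X: "whom a X" "Div X = 0" for X Z :: "'a wit" and a
  proof -
    have "(\<Sum>i\<in>Y. lscale (psign (par i * (a + par i))) (D i (X i \<odot> Z l)))
       = (\<Sum>i\<in>Y. lscale (psign (par i * (a + par i))) (D i (X i))) \<odot> Z l + act X (Z l)"
      unfolding mul_sum_left act_def sum.distrib[symmetric]
      by (intro sum.cong refl) (simp add: D_mul[OF _ whomD[OF X(1)]] lam.scale_right_distrib)
    then show ?thesis
      using X Div_homog[OF X(1)] by simp
  qed
  show "br X Z l = ?R l"
  proof (cases "l \<in> Y")
    case True
    have "?R l = (\<Sum>i\<in>Y. \<Sum>k\<in>Y. (if k = l then lscale (psign (par i * (a + par i))) (D i (X i \<odot> Z k)) else 0)
       - (if i = l then lscale (psign (par i * (a + par i) + par i * par k + (a + b + par i + par k) * (par i + par k)))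
           (D k (X i \<odot> Z k)) else 0))"
      by (subst sum_fun_apply, rule sum.cong[OF refl], subst sum_fun_apply, rule sum.cong[OF refl])
        (auto simp: DD_homog[OF h] psign_add lam.scale_right_distrib lam.scale_right_diff_distrib mult.assoc)
    also have "\<dots> = (\<Sum>i\<in>Y. \<Sum>k\<in>Y. if k = l then lscale (psign (par i * (a + par i))) (D i (X i \<odot> Z k)) else 0)
      - (\<Sum>k\<in>Y. \<Sum>i\<in>Y. if i = l then lscale (psign (par i * (a + par i) + par i * par k + (a + b + par i + par k) * (par i + par k)))
           (D k (X i \<odot> Z k)) else 0)"
      unfolding sum_subtractf by (subst (3) sum.swap) (rule refl)
    also have "\<dots> = act X (Z l)
      - (\<Sum>k\<in>Y. lscale (psign (par l * (a + par l) + par l * par k + (a + b + par l + par k) * (par l + par k)))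
           (D k (X l \<odot> Z k)))"
      using True by (simp add: div[OF X])
    \<comment> \<open>Exchanging X l with Z k costs a sign; what remains is the total-derivative
      form of the action of Z on X l.\<close>
    also have "(\<Sum>k\<in>Y. lscale (psign (par l * (a + par l) + par l * par k + (a + b + par l + par k) * (par l + par k)))
           (D k (X l \<odot> Z k))) = lscale (psign (a * b)) (act Z (X l))"
      unfolding div[OF Z] lam.scale_sum_right
    proof (intro sum.cong refl)
      fix k assume "k \<in> Y"
      then have "X l \<odot> Z k = lscale (psign ((a + par l) * (b + par k))) (Z k \<odot> X l)"
        by (intro mul_commute whomD[OF X(1)] whomD[OF Z(1)] True)
      moreover have "psign (par l * (a + par l) + par l * par k + (a + b + par l + par k) * (par l + par k))
          * psign ((a + par l) * (b + par k)) = (psign (a * b) * psign (par k * (b + par k)) :: 'a)"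
        by (cases a; cases b; cases "par l"; cases "par k"; simp)
      ultimately show "lscale (psign (par l * (a + par l) + par l * par k + (a + b + par l + par k) * (par l + par k)))
           (D k (X l \<odot> Z k)) = lscale (psign (a * b)) (lscale (psign (par k * (b + par k))) (D k (Z k \<odot> X l)))"
        by (simp only: D_scale lam.scale_scale)
    qed
    finally have "?R l = act X (Z l) - lscale (psign (a * b)) (act Z (X l))" .
    then show ?thesis
      using True by (simp only: br_apply[OF X(1) Z(1)] if_True)
  next
    case False
    then have "DD i k f l = 0" if "i \<in> Y" "k \<in> Y" for i k f
      using DD_in_Wset[OF that, of f] by (simp add: Wset_eq)
    then have "?R l = 0"
      by (simp add: sum_fun_apply)
    then show ?thesis
      using False by (simp add: br_apply[OF X(1) Z(1)])
  qed
qed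

lemma S_br:
  assumes "X \<in> S" "Z \<in> S"
  shows "br X Z \<in> S"
proof -
  have "br (wcomp a X) (wcomp b Z) \<in> S" for a b
    unfolding br_divfree[OF whom_wcomp S_Div[OF S_wcomp[OF assms(1)]] whom_wcomp S_Div[OF S_wcomp[OF assms(2)]]]
    by (intro S_sum S_scale DD_in_S Lam_mul)
  then have "br (wcomp 0 X + wcomp 1 X) (wcomp 0 Z + wcomp 1 Z) \<in> S"
    unfolding br_add_left br_add_right by (intro S_add)
  then show ?thesis
    by (simp only: wcomp_parts)
qed

section \<open>Elements of degree -1 and 0 in S\<close>

definition xidx :: "nat \<Rightarrow> idx" where
  "xidx i = (if i \<le> m then ((\<lambda>_. 0)(i := 1), {}) else (\<lambda>_. 0, {i}))"

definition x :: "nat \<Rightarrow> 'a lam" where "x i = mono (xidx i)"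

definition dl :: "nat \<Rightarrow> 'a wit" where "dl i = fD unit i"

text \<open>The field x_k D_l. These fields are the matrix units of gl(m|n), the degree-0 part of
  W.\<close>

definition E :: "nat \<Rightarrow> nat \<Rightarrow> 'a wit" where "E k l = fD (x k) l"

text \<open>The sign is the one that makes this combination of x_i D_i and x_j D_j divergence-free:
  x_i D_i has divergence (-1)^(par i).\<close>

definition H :: "nat \<Rightarrow> nat \<Rightarrow> 'a wit" where
  "H i j = E i i - wscale (psign (par i + par j)) (E j j)"

text \<open>The fields with constant coefficients, that is, the part of degree -1.\<close>

definition cst :: "(nat \<Rightarrow> 'a) \<Rightarrow> 'a wit" where
  "cst c = (\<Sum>k\<in>Y. wscale (c k) (dl k))"

lemma xidx_in_basis: "i \<in> Y \<Longrightarrow> xidx i \<in> \<B>"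
proof -
  assume i: "i \<in> Y"
  \<comment> \<open>This is where t i \<ge> 1 enters: the exponent 1 must not be truncated.\<close>
  have "1 \<le> p ^ t i - 1" if "i \<le> m"
  proof -
    have "p ^ 1 \<le> p ^ t i"
      using t_pos[of i] i that p_gt_2 by (intro power_increasing) (auto simp: Yset_def)
    then show ?thesis using p_gt_2 by simp
  qed
  then show ?thesis
    using i by (auto simp: xidx_def basis_def Aset_def Bset_def Yset_def)
qed

lemma Lam_x: "i \<in> Y \<Longrightarrow> x i \<in> Lm"
  by (simp add: x_def Lam_mono xidx_in_basis)

lemma homog_x: "homog (par i) (x i)"
  by (simp add: x_def homog_mono xidx_def bpar_def ypar_def)

lemma xidx_neq_0: "xidx i \<noteq> (0, {})"
  by (auto simp: xidx_def fun_eq_iff)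

lemma fun_upd_zero: "0(i := (0::nat)) = 0"
  by auto

lemma D_x: "i \<in> Y \<Longrightarrow> j \<in> Y \<Longrightarrow> D j (x i) = (if i = j then unit else 0)"
proof -
  assume ij: "i \<in> Y" "j \<in> Y"
  have *: "{k. k = j \<and> k < j} = {}" by auto
  show ?thesis
    unfolding x_def D_mono[OF xidx_in_basis[OF ij(1)]]
    by (auto simp: xidx_def bder_def unit_def fun_upd_zero zero_fun_def[symmetric] *)
qed

lemma mul_unit_right: "homog a f \<Longrightarrow> f \<in> Lm \<Longrightarrow> f \<odot> unit = f"
  using mul_commute[OF _ homog_unit, of a f] by (simp add: mul_unit_left)

text \<open>A nonconstant monomial in f has some i in its support. Since divided powers are lowered
  without a numerical factor, and distinct monomials not killed by D_i stay distinct, its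
  coefficient survives in D_i f up to sign, also in characteristic p.\<close>

lemma D_kernel:
  assumes f: "f \<in> Lm" and D0: "\<And>i. i \<in> Y \<Longrightarrow> D i f = 0"
  shows "f = lscale (f (0, {})) unit"
proof -
  have off: "f (\<alpha>, u) = 0" if nz: "(\<alpha>, u) \<noteq> (0, {})" for \<alpha> u
  proof (rule ccontr)
    assume fb: "f (\<alpha>, u) \<noteq> 0"
    then have b: "(\<alpha>, u) \<in> \<B>"
      using f by (auto simp: Lam_def)
    have "\<exists>i. \<alpha> i \<noteq> 0 \<or> i \<in> u"
      using nz by (auto simp: fun_eq_iff)
    then obtain i where i: "\<alpha> i \<noteq> 0 \<or> i \<in> u" ..
    have even: "i \<in> {1..m}" if "\<alpha> i \<noteq> 0"
    proof (rule ccontr)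
      assume "i \<notin> {1..m}"
      then have "\<alpha> i = 0"
        using b unfolding basis_def Aset_def by blast
      then show False using that by simp
    qed
    have odd: "m < i" "i \<in> Y" if "i \<in> u"
    proof -
      have "u \<subseteq> {m + 1..m + n}"
        using b by (simp add: basis_def Bset_def)
      then have "i \<in> {m + 1..m + n}"
        using that by (rule subsetD)
      then show "m < i" "i \<in> Y"
        by (simp_all add: Yset_def)
    qed
    from i show False
    proof
      assume "\<alpha> i \<noteq> 0"
      note 1 = even[OF this] this
      have "f c * bd i c (low i \<alpha>, u) = (if c = (\<alpha>, u) then f (\<alpha>, u) else 0)" if "c \<in> \<B>" for c
      proof -
        have eq: "c = (\<alpha>, u)" if "(low i \<alpha>, u) = (low i (fst c), snd c)" "fst c i \<noteq> 0"
        proof -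
          have low: "low i (fst c) k = low i \<alpha> k" for k
            using that(1) by simp
          have "fst c k = \<alpha> k" for k
            using low[of k] that(2) 1 by (cases "k = i") (simp_all add: low_def)
          then show ?thesis
            using that by (simp add: prod_eq_iff fun_eq_iff)
        qed
        show ?thesis
        proof (cases "fst c i = 0")
          case True
          then show ?thesis using 1 by (auto simp: bd_even)
        next
          case False
          then have "(low i \<alpha>, u) \<noteq> (low i (fst c), snd c)" if "c \<noteq> (\<alpha>, u)"
            using that eq by blast
          then show ?thesis
            using 1 False by (cases "c = (\<alpha>, u)") (auto simp add: bd_even mono_el_def)
        qed
      qed
      then have "D i f (low i \<alpha>, u) = f (\<alpha>, u)"
        using b by (simp add: Dd_def sum_fun_apply)
      then show False
        using fb D0[of i] 1 by (simp add: Yset_def)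
    next
      assume "i \<in> u"
      note 2 = this odd[OF this]
      have "f c * bd i c (\<alpha>, u - {i}) = (if c = (\<alpha>, u) then f (\<alpha>, u) * (- 1) ^ below i u else 0)" if "c \<in> \<B>" for c
        using 2 by (cases c) (auto simp: bd_odd mono_el_def)
      then have "D i f (\<alpha>, u - {i}) = f (\<alpha>, u) * (- 1) ^ below i u"
        using b by (simp add: Dd_def sum_fun_apply)
      then show False
        using fb D0[of i] 2 by simp
    qed
  qed
  have "f b = lscale (f (0, {})) unit b" for b
    using off[of "fst b" "snd b"] by (cases "b = (0, {})") (simp_all add: unit_def mono_el_def)
  then show ?thesis
    by (rule ext)
qed

lemma whom_dl: "whom (par i) (dl i)"
  by (auto simp: whom_def dl_def fD_apply homog_unit)

lemma whom_E: "whom (par k + par l) (E k l)"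
  using homog_x[of k] by (auto simp: whom_def E_def fD_apply ac_simps)

lemma whom_diff: "whom a X \<Longrightarrow> whom a Z \<Longrightarrow> whom a (X - Z)"
  by (simp add: whom_def homog_diff)

lemma whom_scale: "whom a X \<Longrightarrow> whom a (wscale c X)"
  by (simp add: whom_def homog_scale)

lemma whom_zero: "whom a 0"
  by (simp add: whom_def)

lemma whom_H: "whom 0 (H i j)"
  unfolding H_def using whom_E[of i i] whom_E[of j j] by (intro whom_diff whom_scale) simp_all

lemma act_fD: "i \<in> Y \<Longrightarrow> act (fD f i) g = f \<odot> D i g"
proof -
  assume i: "i \<in> Y"
  have "act (fD f i) g = (\<Sum>k\<in>Y. if k = i then f \<odot> D i g else 0)"
    unfolding act_def by (intro sum.cong refl) (simp add: fD_apply)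
  then show ?thesis using i by simp
qed

lemma act_unit: "act X unit = 0"
  by (simp add: act_def)

lemma br_dl:
  assumes "i \<in> Y" "whom a Z"
  shows "br (dl i) Z k = (if k \<in> Y then D i (Z k) else 0)"
  unfolding br_apply[OF whom_dl assms(2)] using assms(1)
  by (simp add: dl_def act_fD mul_unit_left Lam_D fD_apply act_unit)

lemma br_dl_E:
  assumes "i \<in> Y" "k \<in> Y" "l \<in> Y"
  shows "br (dl i) (E k l) = (if i = k then dl l else 0)"
  by (rule ext, subst br_dl[OF assms(1) whom_E]) (use assms in \<open>auto simp: E_def fD_apply D_x dl_def\<close>)

lemma br_E_dl:
  assumes "i \<in> Y" "k \<in> Y" "l \<in> Y"
  shows "br (E k l) (dl i) = (if i = k then wscale (- psign (par k * (par k + par l))) (dl l) else 0)"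
  using assms by (simp add: br_skew[OF whom_E whom_dl] br_dl_E mult.commute wit.scale_minus_left)

lemma br_dl_dl: "i \<in> Y \<Longrightarrow> k \<in> Y \<Longrightarrow> br (dl i) (dl k) = 0"
  by (rule ext) (simp add: br_dl[OF _ whom_dl], simp add: dl_def fD_apply)

lemma br_E_E:
  assumes "i \<in> Y" "j \<in> Y" "k \<in> Y" "l \<in> Y"
  shows "br (E k l) (E i j) = (if l = i then E k j else 0)
    - wscale (psign ((par k + par l) * (par i + par j))) (if j = k then E i l else 0)"
proof
  fix q
  show "br (E k l) (E i j) q = ((if l = i then E k j else 0)
    - wscale (psign ((par k + par l) * (par i + par j))) (if j = k then E i l else 0)) q"
    unfolding br_apply[OF whom_E whom_E] using assms
    by (auto simp: E_def act_fD fD_apply D_x mul_unit_right[OF homog_x Lam_x])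
qed

lemma br_E_E_right:
  assumes "i \<in> Y" "j \<in> Y" "k \<in> Y" "i \<noteq> k"
  shows "br (E j k) (E i j) = wscale (- psign ((par j + par k) * (par i + par j))) (E i k)"
  using assms by (simp add: br_E_E wit.scale_minus_left)

lemma br_H_E:
  assumes "j \<in> Y" "k \<in> Y" "l \<in> Y" "k \<noteq> l" "j \<noteq> k" "j \<noteq> l"
  shows "br (H k j) (E k l) = E k l"
  using assms by (simp add: H_def br_diff_left br_scale_left br_E_E)

lemma br_H_H:
  assumes "i \<in> Y" "j \<in> Y" "k \<in> Y" "l \<in> Y"
  shows "br (H k l) (H i j) = 0"
proof -
  have "br (E k k) (E i i) = 0" if "i \<in> Y" "k \<in> Y" for i k
    using that by (simp add: br_E_E)
  then show ?thesis
    using assms by (simp add: H_def br_diff_left br_diff_right br_scale_left br_scale_right)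
qed

lemma br_dl_H:
  assumes "i \<in> Y" "j \<in> Y" "k \<in> Y" "i \<noteq> j"
  shows "br (dl k) (H i j) = (if k = i then dl i else if k = j then - wscale (psign (par i + par j)) (dl j) else 0)"
  using assms by (simp add: H_def br_diff_right br_scale_right br_dl_E)

lemma cst_apply: "cst c k = (if k \<in> Y then lscale (c k) unit else 0)"
proof -
  have "cst c k = (\<Sum>i\<in>Y. if i = k then lscale (c k) unit else 0)"
    unfolding cst_def by (subst sum_fun_apply, rule sum.cong[OF refl]) (simp add: dl_def fD_apply)
  then show ?thesis by simp
qed

lemma sum_Y_delta: "k \<in> Y \<Longrightarrow> (\<Sum>i\<in>Y. wscale (c i) (if i = k then X else 0)) = wscale (c k) X"
proof -
  assume k: "k \<in> Y"
  have "(\<Sum>i\<in>Y. wscale (c i) (if i = k then X else 0)) = (\<Sum>i\<in>Y. if i = k then wscale (c k) X else 0)"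
    by (intro sum.cong refl) auto
  then show ?thesis using k by simp
qed

lemma br_sum_right: "br Z (\<Sum>i\<in>I. F i) = (\<Sum>i\<in>I. br Z (F i))"
  by (induction I rule: infinite_finite_induct)
    (simp_all only: sum.infinite sum.empty sum.insert br_zero br_add_right simp_thms)

lemma br_cst_E:
  assumes "k \<in> Y" "l \<in> Y"
  shows "br (cst c) (E k l) = wscale (c k) (dl l)"
  unfolding cst_def br_sum_left br_scale_left
  using assms sum_Y_delta[of k c "dl l"] by (simp add: br_dl_E)

lemma br_E_cst:
  assumes "k \<in> Y" "l \<in> Y"
  shows "br (E k l) (cst c) = wscale (- (c k * psign (par k * (par k + par l)))) (dl l)"
  unfolding cst_def br_sum_right br_scale_right
  using assms sum_Y_delta[of k c "wscale (- psign (par k * (par k + par l))) (dl l)"] by (simp add: br_E_dl)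

lemma br_H_cst:
  assumes "k \<in> Y" "l \<in> Y" "k \<noteq> l"
  shows "br (H k l) (cst c) = wscale (psign (par k + par l) * c l) (dl l) - wscale (c k) (dl k)"
  unfolding H_def br_diff_left br_scale_left
  using assms by (simp add: br_E_cst wit.scale_minus_left mult.commute)

lemma dl_apply: "dl i k = (if k = i then unit else 0)"
  by (simp add: dl_def fD_apply)

lemma dl_scale_eq_0: "wscale c (dl l) = 0 \<longleftrightarrow> c = 0"
proof -
  have "dl l \<noteq> 0"
  proof
    assume "dl l = 0"
    then have "dl l l = 0 l" by (rule fun_cong)
    then show False by (simp add: dl_apply)
  qed
  then show ?thesis by simp
qed

text \<open>Transitivity of W: bracketing with D_i differentiates each coefficient, so
  \<open>D_kernel\<close> applies to every coefficient separately.\<close>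

lemma br_dl_kernel:
  assumes "X \<in> Wset p m n t" "whom a X" "\<And>i. i \<in> Y \<Longrightarrow> br (dl i) X = 0"
  shows "\<exists>c. X = cst c"
proof
  show "X = cst (\<lambda>k. X k (0, {}))"
  proof
    fix k
    show "X k = cst (\<lambda>k. X k (0, {})) k"
    proof (cases "k \<in> Y")
      case True
      have "D i (X k) = 0" if "i \<in> Y" for i
        using br_dl[OF that assms(2), of k] assms(3)[OF that] True by simp
      then have "X k = lscale (X k (0, {})) unit"
        using assms(1) True by (intro D_kernel) (auto simp: Wset_eq)
      then show ?thesis
        unfolding cst_apply using True by (simp only: if_True)
    next
      case False
      then show ?thesis using assms(1) by (simp add: cst_apply Wset_eq)
    qed
  qed
qed

definition S_hom :: "bit \<Rightarrow> 'a wit \<Rightarrow> bool" where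
  "S_hom a X \<longleftrightarrow> X \<in> S \<and> whom a X"

lemma S_hom_diff: "S_hom a X \<Longrightarrow> S_hom a Z \<Longrightarrow> S_hom a (X - Z)"
  using S_add[of X "wscale (- 1) Z"] S_scale[of Z "- 1"] by (simp add: S_hom_def whom_diff)

lemma S_hom_scale: "S_hom a X \<Longrightarrow> S_hom a (wscale c X)"
  by (simp add: S_hom_def whom_scale S_scale)

lemma S_hom_zero: "S_hom a 0"
  by (simp add: S_hom_def whom_zero S_zero)

lemma S_hom_br: "S_hom a X \<Longrightarrow> S_hom b Z \<Longrightarrow> S_hom (a + b) (br X Z)"
  by (simp add: S_hom_def whom_br S_br)

text \<open>Y has m + n \<ge> 4 elements, which leaves room for an auxiliary index away from three
  given ones.\<close>

lemma exists_Y: "\<exists>j\<in>Y. j \<noteq> i \<and> j \<noteq> k \<and> j \<noteq> l"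
proof -
  have "card {i, k, l} < card Y"
    using m_ge_2 n_ge_2 card_insert_le_m1[of 3 "{k, l}" i] card_insert_le_m1[of 2 "{l}" k]
    by (simp add: Yset_def)
  then have "\<not> Y \<subseteq> {i, k, l}"
    using card_mono[of "{i, k, l}" Y] by auto
  then show ?thesis by auto
qed

lemma DD_x: "i \<in> Y \<Longrightarrow> l \<in> Y \<Longrightarrow> i \<noteq> l \<Longrightarrow> DD i l (x i) = wscale (psign (par i * par l)) (dl l)"
  by (rule ext) (auto simp: DD_homog[OF homog_x] D_x dl_apply)

lemma S_unscale: "wscale (psign a) X \<in> S \<Longrightarrow> X \<in> S"
  using S_scale[of "wscale (psign a) X" "psign a"] by simp

lemma S_hom_dl: "l \<in> Y \<Longrightarrow> S_hom (par l) (dl l)"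
proof -
  assume l: "l \<in> Y"
  obtain i where "i \<in> Y" "i \<noteq> l" using exists_Y by blast
  then show ?thesis
    using DD_in_S[of i l "x i"] l S_unscale[of "par i * par l"] by (auto simp: S_hom_def whom_dl DD_x Lam_x)
qed

lemma D_xx:
  assumes "i \<in> Y" "j \<in> Y" "k \<in> Y"
  shows "D k (x i \<odot> x j) = (if i = k then x j else 0) + (if j = k then lscale (psign (par i * par j)) (x i) else 0)"
  using assms
  by (auto simp: D_mul[OF _ homog_x] D_x mul_unit_left Lam_x mul_unit_right[OF homog_x Lam_x] ac_simps)

text \<open>For a third index i, the generator D_il(x_i x_k) is x_k D_l up to sign: D_l kills the
  product and D_i leaves x_k.\<close>

lemma S_hom_E:
  assumes "k \<in> Y" "l \<in> Y" "k \<noteq> l"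
  shows "S_hom (par k + par l) (E k l)"
proof -
  obtain i where i: "i \<in> Y" "i \<noteq> k" "i \<noteq> l" using exists_Y by blast
  have "DD i l (x i \<odot> x k) = wscale (psign (par i * par l)) (E k l)"
    using i assms
    by (intro ext) (auto simp: DD_homog[OF homog_mul[OF homog_x homog_x]] D_xx E_def fD_apply)
  then have "E k l \<in> S"
    using DD_in_S[of i l "x i \<odot> x k"] i assms S_unscale Lam_mul by auto
  then show ?thesis by (simp add: S_hom_def whom_E)
qed

text \<open>Up to sign the element is the generator D_ij(x_i x_j), in which each derivation removes
  one factor.\<close>

lemma S_hom_H:
  assumes "i \<in> Y" "j \<in> Y" "i \<noteq> j"
  shows "S_hom 0 (H i j)"
proof -
  have "DD i j (x i \<odot> x j) = wscale (- psign (par i + par j + par i * par j)) (H i j)"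
    using assms
    by (intro ext, cases "par i"; cases "par j")
      (auto simp: DD_homog[OF homog_mul[OF homog_x homog_x]] D_xx E_def fD_apply H_def)
  moreover have "wscale (- psign (par i + par j + par i * par j)) (DD i j (x i \<odot> x j)) \<in> S"
    using assms by (intro S_scale DD_in_S Lam_mul)
  ultimately show ?thesis by (simp add: S_hom_def whom_H)
qed

end

section \<open>Skew-symmetric super-biderivations of \<open>S(m,n;t)\<close>\<close>

context witt_super
begin

lemma part_S_alg: "X \<in> part (S_alg p m n t) a \<longleftrightarrow> S_hom a X"
  using S_Wset by (auto simp: S_alg_def Wset_part_eq S_hom_def)

lemma S_alg_simps:
  "carr (S_alg p m n t) = S" "smul (S_alg p m n t) = (wscale :: 'a \<Rightarrow> _)" "brk (S_alg p m n t) = br"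
  by (simp_all add: S_alg_def)

end

section \<open>The four-argument identity for homogeneous super-biderivations\<close>

locale S_biderivation = witt_super field_type p m n t
  for field_type :: "'a::field itself" and p m n t +
  fixes \<phi> :: "'a wit \<Rightarrow> 'a wit \<Rightarrow> 'a wit" and \<gamma> :: bit
  assumes BDer_hom: "\<phi> \<in> BDer_hom (S_alg p m n t :: ('a, 'a wit) superalg) \<gamma>"
begin

lemma phi_hom_bilinear: "\<phi> \<in> hom_bilinear_maps (S_alg p m n t :: ('a, 'a wit) superalg) \<gamma>"
  using BDer_hom unfolding BDer_hom_def by blast

lemma phi_bilinear: "\<phi> \<in> bilinear_maps (S_alg p m n t :: ('a, 'a wit) superalg)"
  using phi_hom_bilinear unfolding hom_bilinear_maps_def by blast

lemma phi_outside: "X \<notin> S \<or> Z \<notin> S \<Longrightarrow> \<phi> X Z = 0"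
  using phi_bilinear unfolding bilinear_maps_def S_alg_simps mem_Collect_eq by (elim conjE) blast

lemma phi_add_left: "X \<in> S \<Longrightarrow> X' \<in> S \<Longrightarrow> Z \<in> S \<Longrightarrow> \<phi> (X + X') Z = \<phi> X Z + \<phi> X' Z"
  using phi_bilinear unfolding bilinear_maps_def S_alg_simps mem_Collect_eq by (elim conjE) blast

lemma phi_add_right: "X \<in> S \<Longrightarrow> Z \<in> S \<Longrightarrow> Z' \<in> S \<Longrightarrow> \<phi> X (Z + Z') = \<phi> X Z + \<phi> X Z'"
  using phi_bilinear unfolding bilinear_maps_def S_alg_simps mem_Collect_eq by (elim conjE) blast

lemma S_hom_phi: "S_hom a X \<Longrightarrow> S_hom b Z \<Longrightarrow> S_hom (a + b + \<gamma>) (\<phi> X Z)"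
  using phi_hom_bilinear unfolding hom_bilinear_maps_def mem_Collect_eq Ball_def part_S_alg by blast

lemma phi_der: "S_hom a X \<Longrightarrow> S_hom b Z \<Longrightarrow> S_hom c V \<Longrightarrow>
    \<phi> X (br Z V) = br (\<phi> X Z) V + wscale (psign ((\<gamma> + a) * b)) (br Z (\<phi> X V))"
  using BDer_hom unfolding BDer_hom_def mem_Collect_eq Ball_def part_S_alg S_alg_simps by blast

lemma phi_skew: "S_hom a X \<Longrightarrow> S_hom b Z \<Longrightarrow> \<phi> X Z = - wscale (psign (\<gamma> * a + \<gamma> * b + a * b)) (\<phi> Z X)"
  using BDer_hom unfolding BDer_hom_def mem_Collect_eq Ball_def part_S_alg S_alg_simps by blast

lemma jacobi: "S_hom a X \<Longrightarrow> S_hom b Z \<Longrightarrow> S_hom c V \<Longrightarrow>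
    br X (br Z V) = br (br X Z) V + wscale (psign (a * b)) (br Z (br X V))"
  by (rule br_jacobi) (auto simp: S_hom_def)

lemma skew: "S_hom a X \<Longrightarrow> S_hom b Z \<Longrightarrow> br X Z = - wscale (psign (a * b)) (br Z X)"
  by (rule br_skew) (auto simp: S_hom_def)

text \<open>Super-skew-symmetry carries the derivation rule over from the second argument.\<close>

lemma phi_der_left:
  assumes X: "S_hom a X" and U: "S_hom b U" and Z: "S_hom c Z"
  shows "\<phi> (br X U) Z = wscale (psign ((\<gamma> + c) * b)) (br (\<phi> X Z) U) + br X (\<phi> U Z)"
  unfolding phi_skew[OF S_hom_br[OF X U] Z] phi_der[OF Z X U] phi_skew[OF Z X] phi_skew[OF Z U]
  by (cases \<gamma>; cases a; cases b; cases c) (simp_all add: br_scale_left br_scale_right)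

text \<open>Up to a common sign, the difference of the two sides of \<open>phi_br\<close>. The signs
  are those produced by the double expansion of \<phi> [X,U] [Z,V]; b and c are the parities of the
  middle arguments Z and U.\<close>

definition defect :: "bit \<Rightarrow> bit \<Rightarrow> 'a wit \<Rightarrow> 'a wit \<Rightarrow> 'a wit \<Rightarrow> 'a wit \<Rightarrow> 'a wit" where
  "defect b c X Z U V = wscale (psign ((\<gamma> + b) * c)) (br (\<phi> X Z) (br U V))
     - wscale (psign ((\<gamma> + c) * b)) (br (br X Z) (\<phi> U V))"

lemma defect_swap_UV:
  assumes X: "S_hom a X" and Z: "S_hom b Z" and U: "S_hom c U" and V: "S_hom d V"
  shows "defect b d X Z V U = wscale (- psign (\<gamma> * (c + d) + b * c + b * d + c * d)) (defect b c X Z U V)"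
  unfolding defect_def phi_skew[OF V U] skew[OF V U]
  by (cases \<gamma>; cases b; cases c; cases d) (simp_all add: br_scale_right wit.scale_right_diff_distrib)

text \<open>Expand \<open>\<phi> (br X U) (br Z V)\<close> in the two possible orders.\<close>

lemma defect_swap_ZV:
  assumes X: "S_hom a X" and Z: "S_hom b Z" and U: "S_hom c U" and V: "S_hom d V"
  shows "defect b c X Z U V = wscale (psign (b * d)) (defect d c X V U Z)"
proof -
  note h = S_hom_phi[OF X Z] S_hom_phi[OF X V] S_hom_phi[OF U Z] S_hom_phi[OF U V]
  have e1: "\<phi> (br X U) (br Z V) = wscale (psign ((\<gamma> + b) * c)) (br (br (\<phi> X Z) U) V) + br (br X (\<phi> U Z)) V
      + wscale (psign ((\<gamma> + a + c) * b)) (wscale (psign ((\<gamma> + d) * c)) (br Z (br (\<phi> X V) U)) + br Z (br X (\<phi> U V)))"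
    unfolding phi_der[OF S_hom_br[OF X U] Z V] phi_der_left[OF X U Z] phi_der_left[OF X U V]
    by (simp add: br_add_left br_add_right br_scale_left br_scale_right ac_simps)
  have e2: "\<phi> (br X U) (br Z V) = wscale (psign ((\<gamma> + b + d) * c)) (br (br (\<phi> X Z) V) U
        + wscale (psign ((\<gamma> + a) * b)) (br (br Z (\<phi> X V)) U))
      + br X (br (\<phi> U Z) V) + wscale (psign ((\<gamma> + c) * b)) (br X (br Z (\<phi> U V)))"
    unfolding phi_der_left[OF X U S_hom_br[OF Z V]] phi_der[OF X Z V] phi_der[OF U Z V]
    by (simp add: br_add_left br_add_right br_scale_left br_scale_right ac_simps)
  \<comment> \<open>Jacobi and skew symmetry are chosen so that the remaining triple brackets cancel
    between the two expansions. The survivors pair a value of \<phi> with a bracket and are the four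
    terms of the two defects.\<close>
  have j1: "br (br (\<phi> X Z) U) V = br (\<phi> X Z) (br U V) - wscale (psign ((a + b + \<gamma>) * c)) (br U (br (\<phi> X Z) V))"
    using jacobi[OF h(1) U V] by simp
  have j2: "br (br (\<phi> X Z) V) U = - wscale (psign (c * (a + b + \<gamma> + d))) (br U (br (\<phi> X Z) V))"
    using skew[OF S_hom_br[OF h(1) V] U] by (simp add: mult.commute)
  have j3: "br X (br (\<phi> U Z) V) = br (br X (\<phi> U Z)) V + wscale (psign (a * (c + b + \<gamma>))) (br (\<phi> U Z) (br X V))"
    using jacobi[OF X h(3) V] .
  have j4: "br Z (br (\<phi> X V) U) = br (br Z (\<phi> X V)) U + wscale (psign (b * (a + d + \<gamma>))) (br (\<phi> X V) (br Z U))"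
    using jacobi[OF Z h(2) U] .
  have j5: "br X (br Z (\<phi> U V)) = br (br X Z) (\<phi> U V) + wscale (psign (a * b)) (br Z (br X (\<phi> U V)))"
    using jacobi[OF X Z h(4)] .
  have s1: "br (\<phi> U Z) (br X V) = - wscale (psign ((c + b + \<gamma>) * (a + d))) (br (br X V) (\<phi> U Z))"
    using skew[OF h(3) S_hom_br[OF X V]] .
  have s2: "br (\<phi> X V) (br Z U) = - wscale (psign (b * c)) (br (\<phi> X V) (br U Z))"
    using skew[OF Z U] by (simp add: br_scale_right)
  note eq = e2[unfolded e1 j1 j2 j3 j4 j5 s1 s2]
  show ?thesis
    using eq unfolding defect_def
    by (cases \<gamma>; cases a; cases b; cases c; cases d) (simp_all add: algebra_simps eq_neg_iff_add_eq_0)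
qed

text \<open>This is the place where the characteristic must differ from 2.\<close>

lemma double_eq_0: "X = - X \<Longrightarrow> X = (0 :: 'a wit)"
proof -
  assume "X = - X"
  then have "wscale 2 X = 0"
    by (metis add.right_inverse one_add_one wit.scale_left_distrib wit.scale_one)
  then show ?thesis
    using two_neq_0 by simp
qed

lemma phi_br:
  assumes X: "S_hom a X" and Z: "S_hom b Z" and U: "S_hom c U" and V: "S_hom d V"
  shows "br (\<phi> X Z) (br U V) = wscale (psign (\<gamma> * (b + c))) (br (br X Z) (\<phi> U V))"
proof -
  have c1: "wscale (psign e) W = W' \<Longrightarrow> W = wscale (psign e) W'"
    and c2: "wscale (- psign e) W = W' \<Longrightarrow> W = wscale (- psign e) W'" for e and W W' :: "'a wit"
    by auto
  \<comment> \<open>The exchanges of Z with V and of the last two arguments alternate. One round is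
    a 3-cycle of Z, U, V, so three rounds return to the start; the three skew exchanges leave a
    total sign -1, and the Koszul signs multiply to 1.\<close>
  have "defect b c X Z U V = wscale (psign (b * d)) (wscale (- psign (\<gamma> * (c + b) + d * c + d * b + c * b))
      (wscale (psign (d * c)) (wscale (- psign (\<gamma> * (b + d) + c * b + c * d + b * d))
      (wscale (psign (c * b)) (wscale (- psign (\<gamma> * (c + d) + b * c + b * d + c * d)) (defect b c X Z U V))))))"
    using defect_swap_ZV[OF X Z U V] defect_swap_UV[OF X V U Z, symmetric, THEN c2] defect_swap_ZV[OF X V Z U]
      defect_swap_UV[OF X U Z V, symmetric, THEN c2] defect_swap_ZV[OF X U V Z] defect_swap_UV[OF X Z U V]
    by presburger
  then have "defect b c X Z U V = - defect b c X Z U V"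
    by (cases \<gamma>; cases b; cases c; cases d) simp_all
  then have "defect b c X Z U V = 0"
    by (rule double_eq_0)
  then have "br (\<phi> X Z) (br U V) = wscale (psign ((\<gamma> + b) * c)) (wscale (psign ((\<gamma> + c) * b)) (br (br X Z) (\<phi> U V)))"
    unfolding defect_def by (intro c1) simp
  then show ?thesis
    by (cases \<gamma>; cases b; cases c) simp_all
qed

end

section \<open>The centralizer of the derived algebra\<close>

context witt_super
begin

lemma cst_eq_0: "(\<And>k. k \<in> Y \<Longrightarrow> c k = 0) \<Longrightarrow> cst c = 0"
  by (simp add: cst_def)

lemma cst_of_br_dl:
  assumes X: "S_hom a X" and "\<And>i. i \<in> Y \<Longrightarrow> br X (dl i) = 0"
  shows "\<exists>c. X = cst c"
  using assms br_dl_kernel[of X a] br_skew[OF whom_dl, of a X] by (simp add: S_hom_def S_Wset)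

text \<open>As D_i = [D_i, H i j] is a bracket, X commutes with every D_i and is constant. As x_k
  D_l = [H k j, x_k D_l] is a bracket too, its k-th coefficient vanishes.\<close>

lemma centralizer_derived:
  assumes X: "S_hom a X" and *: "\<And>b c U V. S_hom b U \<Longrightarrow> S_hom c V \<Longrightarrow> br X (br U V) = 0"
  shows "X = 0"
proof -
  have "br X (dl i) = 0" if i: "i \<in> Y" for i
  proof -
    obtain j where "j \<in> Y" "j \<noteq> i" using exists_Y by blast
    then show ?thesis
      using *[OF S_hom_dl[OF i] S_hom_H[OF i, of j]] i by (simp add: br_dl_H)
  qed
  then obtain c where c: "X = cst c"
    using cst_of_br_dl[OF X] by blast
  have "c k = 0" if k: "k \<in> Y" for k
  proof -
    obtain l where l: "l \<in> Y" "l \<noteq> k" using exists_Y by blast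
    obtain j where j: "j \<in> Y" "j \<noteq> k" "j \<noteq> l" using exists_Y by blast
    have "br X (E k l) = 0"
      using *[OF S_hom_H[OF k j(1)] S_hom_E[OF k l(1)]] k l j by (simp add: br_H_E)
    then show ?thesis
      using k l by (simp add: c br_cst_E dl_scale_eq_0 del: wit.scale_eq_0_iff)
  qed
  then show ?thesis
    by (simp add: c cst_eq_0)
qed

end

section \<open>Determination of the homogeneous biderivations\<close>

context S_biderivation
begin

lemma phi_eq_0:
  assumes "S_hom a X" "S_hom b Z" "br X Z = 0"
  shows "\<phi> X Z = 0"
  by (rule centralizer_derived[OF S_hom_phi[OF assms(1,2)]]) (simp add: phi_br[OF assms(1,2)] assms(3))

lemma phi_dl_H:
  assumes ij: "i \<in> Y" "j \<in> Y" "i \<noteq> j"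
  shows "\<exists>c. \<phi> (dl i) (H i j) = wscale c (dl i) \<and> (\<gamma> = 1 \<longrightarrow> c = 0)"
proof -
  let ?W = "\<phi> (dl i) (H i j)"
  have W: "S_hom (par i + 0 + \<gamma>) ?W"
    using ij by (intro S_hom_phi S_hom_dl S_hom_H)
  \<comment> \<open>The map \<phi> (dl i) kills D_k as well as [D_k, H i j], which is a multiple of
    D_k. The derivation rule for that bracket leaves just the bracket of D_k with the value.\<close>
  have "br (dl k) ?W = 0" if k: "k \<in> Y" for k
  proof -
    have "\<phi> (dl i) (dl k) = 0"
      using ij k by (intro phi_eq_0[OF S_hom_dl S_hom_dl]) (simp_all add: br_dl_dl)
    moreover have "\<phi> (dl i) (br (dl k) (H i j)) = 0"
      using ij k by (intro phi_eq_0[OF S_hom_dl S_hom_br[OF S_hom_dl S_hom_H]])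
        (simp_all add: br_dl_H br_dl_dl br_scale_right)
    ultimately show ?thesis
      using phi_der[OF S_hom_dl[OF ij(1)] S_hom_dl[OF k] S_hom_H[OF ij]] by simp
  qed
  then obtain c where c: "?W = cst c"
    using br_dl_kernel[of ?W] W by (auto simp: S_hom_def S_Wset)
  \<comment> \<open>With k and l different from i, H k l commutes with D_i and H i j, hence also
    with the value, while it acts on D_k by the scalar -1.\<close>
  have c0: "c k = 0" if k: "k \<in> Y" "k \<noteq> i" for k
  proof -
    obtain l where l: "l \<in> Y" "l \<noteq> i" "l \<noteq> k" using exists_Y by blast
    have "\<phi> (dl i) (H k l) = 0"
      using ij k l by (intro phi_eq_0[OF S_hom_dl S_hom_H]) (simp_all add: br_dl_H)
    moreover have "\<phi> (dl i) (br (H k l) (H i j)) = 0"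
      using ij k l by (intro phi_eq_0[OF S_hom_dl S_hom_br[OF S_hom_H S_hom_H]]) (simp_all add: br_H_H)
    ultimately have "br (H k l) (cst c) = 0"
      using phi_der[OF S_hom_dl[OF ij(1)] S_hom_H[OF k(1) l(1)] S_hom_H[OF ij]] l by (simp add: c)
    then have "(wscale (psign (par k + par l) * c l) (dl l) - wscale (c k) (dl k)) k = 0 k"
      using k l by (simp add: br_H_cst)
    then show ?thesis
      using k l by (simp add: dl_apply)
  qed
  have "?W = wscale (c i) (dl i)"
    unfolding c by (rule ext) (auto simp: cst_apply dl_apply c0 ij)
  \<comment> \<open>For odd \<phi> the value has parity par i + 1, whereas D_i has parity par
    i.\<close>
  moreover have "c i = 0" if "\<gamma> = 1"
  proof (rule ccontr)
    assume "c i \<noteq> 0"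
    then have "?W i (0, {}) \<noteq> 0"
      using ij by (simp add: c cst_apply unit_def mono_el_def)
    moreover have "homog (par i + 0 + \<gamma> + par i) (?W i)"
      using W ij by (intro whomD) (simp_all add: S_hom_def)
    ultimately have "bpar (0, {}) = par i + 0 + \<gamma> + par i"
      using homogD by blast
    then show False
      using that by (simp add: bpar_def ac_simps)
  qed
  ultimately show ?thesis by blast
qed

text \<open>Take U = D_i and V = H i j in \<open>phi_br\<close>: then [U,V] = D_i, and \<phi> U V is
  a multiple of D_i. The sign is 1 for \<gamma> = 0, and for \<gamma> = 1 the multiple is 0.\<close>

lemma br_phi_dl:
  assumes i: "i \<in> Y"
  shows "\<exists>c. (\<gamma> = 1 \<longrightarrow> c = 0) \<and>
    (\<forall>a b X Z. S_hom a X \<longrightarrow> S_hom b Z \<longrightarrow> br (\<phi> X Z) (dl i) = wscale c (br (br X Z) (dl i)))"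
proof -
  obtain j where j: "j \<in> Y" "i \<noteq> j" using exists_Y by blast
  obtain c where c: "\<phi> (dl i) (H i j) = wscale c (dl i)" "\<gamma> = 1 \<longrightarrow> c = 0"
    using phi_dl_H[OF i j] by blast
  have "br (\<phi> X Z) (dl i) = wscale c (br (br X Z) (dl i))" if "S_hom a X" "S_hom b Z" for a b X Z
    using phi_br[OF that S_hom_dl[OF i] S_hom_H[OF i j]] c(2) i j
    by (cases \<gamma>) (simp_all add: br_dl_H c(1) br_scale_right)
  then show ?thesis
    using c(2) by blast
qed

text \<open>The condition on c reconciles the parity a + b of V with that of the value: for odd
  \<phi> nothing is subtracted.\<close>

lemma S_hom_phi_diff:
  assumes "S_hom a X" "S_hom b Z" "\<gamma> = 1 \<longrightarrow> c = 0" "S_hom (a + b) V"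
  shows "S_hom (a + b + \<gamma>) (\<phi> X Z - wscale c V)"
  using assms S_hom_phi[OF assms(1,2)] by (cases \<gamma>) (auto intro: S_hom_diff S_hom_scale)

lemma phi_inner:
  "\<exists>c. (\<gamma> = 1 \<longrightarrow> c = 0) \<and> (\<forall>a b X Z. S_hom a X \<longrightarrow> S_hom b Z \<longrightarrow> \<phi> X Z = wscale c (br X Z))"
proof -
  obtain \<mu> where lam0: "\<And>i. i \<in> Y \<Longrightarrow> \<gamma> = 1 \<longrightarrow> \<mu> i = 0"
    and lam: "\<And>i a b X Z. i \<in> Y \<Longrightarrow> S_hom a X \<Longrightarrow> S_hom b Z \<Longrightarrow>
      br (\<phi> X Z) (dl i) = wscale (\<mu> i) (br (br X Z) (dl i))"
    using br_phi_dl by metis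
  have phi_H_E: "\<exists>c. \<phi> (H k q) (E k l) = wscale (\<mu> k) (E k l) + cst c"
    if "k \<in> Y" "l \<in> Y" "q \<in> Y" "k \<noteq> l" "q \<noteq> k" "q \<noteq> l" for k l q
  proof -
    have h: "S_hom 0 (H k q)" "S_hom (par k + par l) (E k l)"
      using that by (auto intro: S_hom_H S_hom_E)
    note muk = lam0[OF \<open>k \<in> Y\<close>]
    have hE: "S_hom (0 + (par k + par l)) (E k l)"
      using h(2) by simp
    have brHE: "br (H k q) (E k l) = E k l"
      using that by (simp add: br_H_E)
    \<comment> \<open>The bracket of x_k D_l with D_i is 0 unless i = k, so the single scalar \<mu>
      k serves for every i.\<close>
    have "br (\<phi> (H k q) (E k l) - wscale (\<mu> k) (E k l)) (dl i) = 0" if "i \<in> Y" for i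
      using lam[OF that h] \<open>k \<in> Y\<close> \<open>l \<in> Y\<close> \<open>k \<noteq> l\<close> \<open>q \<noteq> k\<close> that
      by (auto simp: brHE br_diff_left br_scale_left br_E_dl)
    then obtain c where "\<phi> (H k q) (E k l) - wscale (\<mu> k) (E k l) = cst c"
      using cst_of_br_dl[OF S_hom_phi_diff[OF h muk hE]] by blast
    then show ?thesis
      by (metis diff_add_cancel add.commute)
  qed
  have lam_eq: "\<mu> i = \<mu> j" if ij: "i \<in> Y" "j \<in> Y" "i \<noteq> j" for i j
  proof (cases "\<gamma> = 0")
    case zero: True
    obtain k where k: "k \<in> Y" "k \<noteq> i" "k \<noteq> j" using exists_Y by blast
    obtain q where q: "q \<in> Y" "q \<noteq> j" "q \<noteq> k" using exists_Y by blast
    obtain r where r: "r \<in> Y" "r \<noteq> i" "r \<noteq> j" using exists_Y by blast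
    obtain c where c: "\<phi> (H j q) (E j k) = wscale (\<mu> j) (E j k) + cst c"
      using phi_H_E ij k q by metis
    obtain c' where c': "\<phi> (H i r) (E i j) = wscale (\<mu> i) (E i j) + cst c'"
      using phi_H_E ij r by metis
    let ?s = "psign ((par j + par k) * (par i + par j)) :: 'a"
    \<comment> \<open>\<open>phi_br\<close> for the pairs (H j q, E j k) and (H i r, E i j), whose
      brackets are E j k and E i j. Both sides contain the same multiple of x_i D_k, scaled by \<mu>
      j and by \<mu> i.\<close>
    have "br (wscale (\<mu> j) (E j k) + cst c) (E i j) = br (E j k) (wscale (\<mu> i) (E i j) + cst c')"
      using phi_br[OF S_hom_H[of j q] S_hom_E[of j k] S_hom_H[of i r] S_hom_E[of i j]] ij k q r zero
      by (simp add: br_H_E c c')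
    then have "wscale (\<mu> j * - ?s) (E i k) + wscale (c i) (dl j)
        = wscale (\<mu> i * - ?s) (E i k) - wscale (c' j * psign (par j * (par j + par k))) (dl k)"
      using ij k by (simp add: br_add_left br_add_right br_scale_left br_scale_right br_E_E_right
          br_cst_E br_E_cst wit.scale_minus_left)
    \<comment> \<open>Compare coefficients of x_i D_k; constant fields contribute only at the index
      (0, {}), which differs from xidx i.\<close>
    then have "(wscale (\<mu> j * - ?s) (E i k) + wscale (c i) (dl j)) k (xidx i)
        = (wscale (\<mu> i * - ?s) (E i k) - wscale (c' j * psign (par j * (par j + par k))) (dl k)) k (xidx i)"
      by (rule fun_cong[OF fun_cong])
    then show ?thesis
      using k xidx_neq_0[of i] by (simp add: E_def fD_apply dl_apply x_def mono_el_def unit_def)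
  qed (use lam0 that in simp)
  obtain i0 where i0: "i0 \<in> Y" using exists_Y by blast
  define L where "L = \<mu> i0"
  have L: "\<mu> i = L" if "i \<in> Y" for i
    using lam_eq[OF that i0] by (auto simp: L_def)
  have L0: "\<gamma> = 1 \<longrightarrow> L = 0"
    using lam0[OF i0] by (simp add: L_def)
  have phi_cst: "\<exists>c. \<phi> X Z = wscale L (br X Z) + cst c" if h: "S_hom a X" "S_hom b Z" for a b X Z
  proof -
    have "br (\<phi> X Z - wscale L (br X Z)) (dl i) = 0" if "i \<in> Y" for i
      using lam[OF that h] that by (simp add: br_diff_left br_scale_left L)
    then obtain c where "\<phi> X Z - wscale L (br X Z) = cst c"
      using cst_of_br_dl[OF S_hom_phi_diff[OF h L0 S_hom_br[OF h]]] by blast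
    then show ?thesis
      by (metis diff_add_cancel add.commute)
  qed
  \<comment> \<open>\<open>phi_br\<close> against [H k q, E k l] = E k l: the terms with L cancel,
    and the constant field of \<phi> X Z contributes c k times D_l.\<close>
  have cst_br: "wscale (c k) (dl l) = wscale (psign (\<gamma> * b)) (br (br X Z) (cst c'))"
    if h: "S_hom a X" "S_hom b Z" and k: "k \<in> Y" "l \<in> Y" "k \<noteq> l" "q \<in> Y" "q \<noteq> k" "q \<noteq> l"
      and c: "\<phi> X Z = wscale L (br X Z) + cst c"
      and c': "\<phi> (H k q) (E k l) = wscale L (E k l) + cst c'" for a b X Z k l q c c'
  proof -
    have "br (wscale L (br X Z) + cst c) (E k l) = wscale (psign (\<gamma> * b)) (br (br X Z) (wscale L (E k l) + cst c'))"
      using phi_br[OF h S_hom_H[of k q] S_hom_E[of k l]] k by (simp add: c c' br_H_E)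
    then show ?thesis
      using L0 k by (cases \<gamma>; cases b) (simp_all add: br_add_left br_add_right br_scale_left br_scale_right br_cst_E)
  qed
  have H_E_0: "cst c' = 0"
    if k: "k \<in> Y" "l \<in> Y" "k \<noteq> l" "q \<in> Y" "q \<noteq> k" "q \<noteq> l"
      and c': "\<phi> (H k q) (E k l) = wscale L (E k l) + cst c'" for k l q c'
  proof (rule cst_eq_0)
    fix i assume i: "i \<in> Y"
    \<comment> \<open>Taking X = H i r and Z = E i j turns the right side of \<open>cst_br\<close>
      into a multiple of D_j with factor c' i up to sign, while the left side is a multiple of D_l.
      The choice j \<noteq> l separates the two.\<close>
    obtain j where j: "j \<in> Y" "j \<noteq> i" "j \<noteq> l" using exists_Y by blast
    obtain r where r: "r \<in> Y" "r \<noteq> i" "r \<noteq> j" using exists_Y by blast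
    obtain c where c: "\<phi> (H i r) (E i j) = wscale L (br (H i r) (E i j)) + cst c"
      using phi_cst[OF S_hom_H[of i r] S_hom_E[of i j]] i j r by metis
    have "wscale (c k) (dl l) = wscale (psign (\<gamma> * (par i + par j))) (br (br (H i r) (E i j)) (cst c'))"
      using cst_br[OF S_hom_H[of i r] S_hom_E[of i j] k c c'] i j r by auto
    then have "wscale (c k) (dl l) j = wscale (psign (\<gamma> * (par i + par j))) (br (E i j) (cst c')) j"
      using i j r by (simp add: br_H_E)
    then show "c' i = 0"
      using i j by (simp add: br_E_cst dl_apply)
  qed
  have "\<phi> X Z = wscale L (br X Z)" if h: "S_hom a X" "S_hom b Z" for a b X Z
  proof -
    obtain c where c: "\<phi> X Z = wscale L (br X Z) + cst c"
      using phi_cst[OF h] by blast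
    have "c k = 0" if k: "k \<in> Y" for k
    proof -
      obtain l where l: "l \<in> Y" "k \<noteq> l" using exists_Y by blast
      obtain q where q: "q \<in> Y" "q \<noteq> k" "q \<noteq> l" using exists_Y by blast
      obtain c' where c': "\<phi> (H k q) (E k l) = wscale L (E k l) + cst c'"
        using phi_H_E[OF k l(1) q(1)] l q L[OF k] by metis
      \<comment> \<open>The constant field belonging to \<phi> (H k q) (E k l) is already known to
        be 0, so the right side of \<open>cst_br\<close> vanishes.\<close>
      have "wscale (c k) (dl l) = 0"
        using cst_br[OF h k l q c c'] H_E_0[OF k l q c'] by simp
      then show ?thesis
        by (simp only: dl_scale_eq_0)
    qed
    then show ?thesis
      by (simp add: c cst_eq_0)
  qed
  then show ?thesis
    using L0 by blast
qed

text \<open>Biadditivity passes from homogeneous arguments to all of S, and outside S both functions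
  take the value 0.\<close>

lemma phi_eq_inner: "\<exists>c. (\<gamma> = 1 \<longrightarrow> c = 0) \<and> \<phi> = inner_bider (S_alg p m n t) c"
proof -
  obtain c where c0: "\<gamma> = 1 \<longrightarrow> c = 0"
    and c: "\<And>a b X Z. S_hom a X \<Longrightarrow> S_hom b Z \<Longrightarrow> \<phi> X Z = wscale c (br X Z)"
    using phi_inner by blast
  have "\<phi> X Z = wscale c (br X Z)" if "X \<in> S" "Z \<in> S" for X Z
  proof -
    note W = S_wcomp[OF that(1)] S_wcomp[OF that(2)]
    have parts: "\<phi> (wcomp a X) (wcomp b Z) = wscale c (br (wcomp a X) (wcomp b Z))" for a b
      using W by (intro c[of a _ b]) (auto simp: S_hom_def whom_wcomp)
    have "\<phi> (wcomp 0 X + wcomp 1 X) (wcomp 0 Z + wcomp 1 Z)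
        = wscale c (br (wcomp 0 X + wcomp 1 X) (wcomp 0 Z + wcomp 1 Z))"
      using W by (simp add: phi_add_left phi_add_right S_add br_add_left br_add_right
          wit.scale_right_distrib parts)
    then show ?thesis
      by (simp only: wcomp_parts)
  qed
  then have "\<phi> = inner_bider (S_alg p m n t) c"
    by (intro ext) (auto simp: inner_bider_def S_alg_simps phi_outside)
  then show ?thesis
    using c0 by blast
qed

end

section \<open>Inner maps and the equality of the two sets\<close>

context witt_super
begin

text \<open>The two axioms are the Jacobi identity and super-skew-symmetry of the bracket,
  multiplied by c.\<close>

lemma inner_bider_in_BDer_hom: "inner_bider (S_alg p m n t) c \<in> BDer_hom (S_alg p m n t :: ('a, 'a wit) superalg) 0"
proof -
  let ?f = "inner_bider (S_alg p m n t :: ('a, 'a wit) superalg) c"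
  have f: "?f X Z = (if X \<in> S \<and> Z \<in> S then wscale c (br X Z) else 0)" for X Z
    by (simp add: inner_bider_def S_alg_simps)
  have fP: "?f X Z = wscale c (br X Z)" if "S_hom a X" "S_hom b Z" for a b X Z
    using that by (simp add: f S_hom_def)
  have "?f \<in> bilinear_maps (S_alg p m n t)"
    unfolding bilinear_maps_def mem_Collect_eq S_alg_simps
    by (auto simp: f S_br S_scale S_add br_add_left br_add_right br_scale_left br_scale_right
        wit.scale_right_distrib mult.commute)
  moreover have "S_hom (a + b + 0) (?f X Z)" if "S_hom a X" "S_hom b Z" for a b X Z
    using S_hom_scale[OF S_hom_br[OF that]] by (simp add: fP[OF that])
  moreover have "?f X (br Z V) = br (?f X Z) V + wscale (psign ((0 + a) * b)) (br Z (?f X V))"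
    if "S_hom a X" "S_hom b Z" "S_hom d V" for a b d X Z V
    using br_jacobi[of a X b Z d V] that
    by (simp add: fP[OF that(1) S_hom_br[OF that(2,3)]] fP[OF that(1,2)] fP[OF that(1,3)] S_hom_def
        br_scale_left br_scale_right wit.scale_right_distrib mult.commute)
  moreover have "?f X Z = - wscale (psign (0 * a + 0 * b + a * b)) (?f Z X)" if "S_hom a X" "S_hom b Z" for a b X Z
    using br_skew[of a X b Z] that by (simp add: fP[OF that] fP[OF that(2,1)] S_hom_def mult.commute)
  ultimately show ?thesis
    unfolding BDer_hom_def hom_bilinear_maps_def mem_Collect_eq Ball_def part_S_alg S_alg_simps by blast
qed

lemma inner_bider_0: "inner_bider (S_alg p m n t :: ('a, 'a wit) superalg) 0 = 0"
  by (intro ext) (simp add: inner_bider_def S_alg_simps)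

lemma zero_in_BDer_hom: "0 \<in> BDer_hom (S_alg p m n t :: ('a, 'a wit) superalg) a"
  unfolding BDer_hom_def hom_bilinear_maps_def bilinear_maps_def mem_Collect_eq Ball_def part_S_alg S_alg_simps
  by (simp add: S_zero S_hom_zero)

lemma BDer_eq_IBDer: "BDer (S_alg p m n t :: ('a, 'a wit) superalg) = IBDer (S_alg p m n t)"
proof (intro equalityI subsetI)
  fix \<psi> assume "\<psi> \<in> BDer (S_alg p m n t :: ('a, 'a wit) superalg)"
  then obtain \<phi>0 \<phi>1 where psi: "\<psi> = \<phi>0 + \<phi>1"
    and "\<phi>0 \<in> BDer_hom (S_alg p m n t :: ('a, 'a wit) superalg) 0"
    and "\<phi>1 \<in> BDer_hom (S_alg p m n t :: ('a, 'a wit) superalg) 1"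
    unfolding BDer_def by blast
  then interpret even: S_biderivation field_type p m n t \<phi>0 0 + odd: S_biderivation field_type p m n t \<phi>1 1
    by unfold_locales
  obtain c where "\<phi>0 = inner_bider (S_alg p m n t) c"
    using even.phi_eq_inner by blast
  \<comment> \<open>For \<gamma> = 1 the scalar is forced to be 0, so the odd summand
    disappears.\<close>
  moreover have "\<phi>1 = 0"
    using odd.phi_eq_inner inner_bider_0 by auto
  ultimately show "\<psi> \<in> IBDer (S_alg p m n t)"
    by (simp add: psi IBDer_def)
next
  fix \<psi> assume "\<psi> \<in> IBDer (S_alg p m n t :: ('a, 'a wit) superalg)"
  then obtain c where "\<psi> = inner_bider (S_alg p m n t) c + 0"
    by (auto simp: IBDer_def)
  then show "\<psi> \<in> BDer (S_alg p m n t)"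
    unfolding BDer_def using inner_bider_in_BDer_hom zero_in_BDer_hom by blast
qed

end

theorem theorem4p12:
  fixes p m n :: nat and t :: "nat \<Rightarrow> nat"
  assumes "CHAR('a::field) = p" and "p > 2"
    and "m \<ge> 2" and "n \<ge> 2"
    and "\<And>i. i \<in> {1..m} \<Longrightarrow> t i \<ge> 1"
  shows "BDer (S_alg p m n t :: ('a, 'a wit) superalg) = IBDer (S_alg p m n t)"
proof -
  interpret witt_super "TYPE('a)" p m n t
    using assms by unfold_locales auto
  show ?thesis
    by (rule BDer_eq_IBDer)
qed

end
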